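(* Assume (A1) and (A2). Let $\bar Z\in\mathcal{Z}_\star$, $\bar H\in\mathcal{C}(\bar Z)$ and $W^{(0)}\in\mathbb{S}^n$, and define $$W^{(k+1)}:=W^{(k)}+\delta''(\bar Z;\bar H,W^{(k)}).$$ Then the limits $$\phi_X(\bar Z;\bar H):=\lim_{k\to\infty}\big(\Pi_+''(\bar Z;\bar H,W^{(k+1)})-\Pi_+''(\bar Z;\bar H,W^{(k)})\big),$$ $$\phi_S(\bar Z;\bar H):=-\frac{1}{\sigma}\lim_{k\to\infty}\big(\Pi_-''(\bar Z;\bar H,W^{(k+1)})-\Pi_-''(\bar Z;\bar H,W^{(k)})\big)$$ exist and satisfy $$\phi_X(\bar Z;\bar H)=\Theta_{\bar H}(\phi(\bar Z;\bar H)),\qquad \phi_S(\bar Z;\bar H)=-\frac{1}{\sigma}\Theta^\perp_{\bar H}(\phi(\bar Z;\bar H)),\qquad \phi(\bar Z;\bar H)=\phi_X(\bar Z;\bar H)-\sigma\phi_S(\bar Z;\bar H).$$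
   Context: Notation: $\mathbb{S}^n$ is the space of real symmetric $n\times n$ matrices with $\langle A,B\rangle=\mathrm{tr}(AB)$. $\Pi_+$, $\Pi_-$ are the orthogonal projections onto the PSD and NSD cones. For $F\in\{\Pi_+,\Pi_-\}$: $$F'(Z;H):=\lim_{t\downarrow0}\frac{F(Z+tH)-F(Z)}{t},\qquad F''(Z;H,W):=\lim_{t\downarrow0}\frac{F(Z+tH+\tfrac{t^2}{2}W)-F(Z)-tF'(Z;H)}{t^2/2}.$$ SDP data $C,A_1,\dots,A_m\in\mathbb{S}^n$, $b\in\mathbb{R}^m$ define $\mathcal{A}X:=(\langle A_i,X\rangle)_i$ and $\mathcal{A}^*y:=\sum_iy_iA_i$. A KKT point is $(X,y,S)$ with $\mathcal{A}X=b$, $\mathcal{A}^*y+S=C$, $X,S\succeq0$, $\langle X,S\rangle=0$. $\mathcal{X}_\star$, $\mathcal{S}_\star$ are the sets of $X$, resp. $S$, in KKT points. (A1) $\mathcal{A}$ is surjective. (A2) Some KKT point $(X_{sc},y_{sc},S_{sc})$ has $\mathrm{rank}X_{sc}+\mathrm{rank}S_{sc}=n$. Let $\mathcal{P}:=\mathcal{A}^*(\mathcal{A}\mathcal{A}^* )^{-1}\mathcal{A}$ and $\mathcal{P}^\perp:=\mathrm{Id}-\mathcal{P}$. Fix $\sigma>0$ and let $\mathcal{Z}_\star:=\{X-\sigma S:X\in\mathcal{X}_\star,S\in\mathcal{S}_\star\}$. For $\bar Z\in\mathcal{Z}_\star$: $$\delta'(\bar Z;H):=-\mathcal{P}\Pi_+'(\bar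 Z;H)-\mathcal{P}^\perp\Pi_-'(\bar Z;H),\qquad \delta''(\bar Z;H,W):=-\mathcal{P}\Pi_+''(\bar Z;H,W)-\mathcal{P}^\perp\Pi_-''(\bar Z;H,W),$$ and $\mathcal{C}(\bar Z):=\{H:\delta'(\bar Z;H)=0\}$. Let $P_0$ be the projector onto $\ker\bar Z$ and $\bar Z^\dagger$ the Moore–Penrose pseudoinverse. For $\bar H\in\mathcal{C}(\bar Z)$ let $\Upsilon:=2P_0\bar H\bar Z^\dagger\bar HP_0$ and $$\Theta_{\bar H}(V):=\Pi_+''(\bar Z;\bar H,V+\Upsilon)-\Pi_+''(\bar Z;\bar H,\Upsilon),\qquad \Theta^\perp_{\bar H}(V):=\Pi_-''(\bar Z;\bar H,V+\Upsilon)-\Pi_-''(\bar Z;\bar H,\Upsilon).$$ Let $\Psi:=\delta''(\bar Z;\bar H,\Upsilon)$ and $\mathcal{K}:=\mathrm{cl}\{\mathcal{P}\Theta_{\bar H}(V)+\mathcal{P}^\perp\Theta^\perp_{\bar H}(V):V\in\mathbb{S}^n\}$, a closed convex cone. Then $\phi(\bar Z;\bar H):=\Psi-\Pi_{\mathcal{K}}(\Psi)$. *)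

theory Defs
  imports "HOL-Analysis.Analysis"
begin

type_synonym 'n mat = "real^'n^'n"

definition Sym :: "'n::finite mat set" where
  "Sym = {M. transpose M = M}"

definition inprod :: "'n::finite mat \<Rightarrow> 'n mat \<Rightarrow> real" where
  "inprod A B = trace (A ** B)"

definition PSD :: "'n::finite mat set" where
  "PSD = {M \<in> Sym. \<forall>x. x \<bullet> (M *v x) \<ge> 0}"

definition NSD :: "'n::finite mat set" where
  "NSD = {M \<in> Sym. \<forall>x. x \<bullet> (M *v x) \<le> 0}"

definition proj_plus :: "'n::finite mat \<Rightarrow> 'n mat" where
  "proj_plus Z = closest_point PSD Z"

definition proj_minus :: "'n::finite mat \<Rightarrow> 'n mat" where
  "proj_minus Z = closest_point NSD Z"

definition dir1 :: "('n::finite mat \<Rightarrow> 'n mat) \<Rightarrow> 'n mat \<Rightarrow> 'n mat \<Rightarrow> 'n mat" where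
  "dir1 F Z H = Lim (at_right (0::real)) (\<lambda>t. (F (Z + t *\<^sub>R H) - F Z) /\<^sub>R t)"

definition dir2 :: "('n::finite mat \<Rightarrow> 'n mat) \<Rightarrow> 'n mat \<Rightarrow> 'n mat \<Rightarrow> 'n mat \<Rightarrow> 'n mat" where
  "dir2 F Z H W = Lim (at_right (0::real))
     (\<lambda>t. (F (Z + t *\<^sub>R H + (t^2/2) *\<^sub>R W) - F Z - t *\<^sub>R dir1 F Z H) /\<^sub>R (t^2/2))"

definition opA :: "('m::finite \<Rightarrow> 'n::finite mat) \<Rightarrow> 'n mat \<Rightarrow> real^'m" where
  "opA A X = (\<chi> i. inprod (A i) X)"

definition adjA :: "('m::finite \<Rightarrow> 'n::finite mat) \<Rightarrow> real^'m \<Rightarrow> 'n mat" where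
  "adjA A y = (\<Sum>i\<in>UNIV. (y $ i) *\<^sub>R A i)"

text \<open>The matrix of A A*.\<close>
definition gramA :: "('m::finite \<Rightarrow> 'n::finite mat) \<Rightarrow> real^'m^'m" where
  "gramA A = (\<chi> i j. inprod (A i) (A j))"

definition projP :: "('m::finite \<Rightarrow> 'n::finite mat) \<Rightarrow> 'n mat \<Rightarrow> 'n mat" where
  "projP A X = adjA A (matrix_inv (gramA A) *v opA A X)"

definition projPperp :: "('m::finite \<Rightarrow> 'n::finite mat) \<Rightarrow> 'n mat \<Rightarrow> 'n mat" where
  "projPperp A X = X - projP A X"

definition KKT :: "'n::finite mat \<Rightarrow> ('m::finite \<Rightarrow> 'n mat) \<Rightarrow> real^'m
                   \<Rightarrow> 'n mat \<Rightarrow> real^'m \<Rightarrow> 'n mat \<Rightarrow> bool" where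
  "KKT C A b X y S \<longleftrightarrow> opA A X = b \<and> adjA A y + S = C \<and> X \<in> PSD \<and> S \<in> PSD
      \<and> inprod X S = 0"

definition Xstar :: "'n::finite mat \<Rightarrow> ('m::finite \<Rightarrow> 'n mat) \<Rightarrow> real^'m \<Rightarrow> 'n mat set" where
  "Xstar C A b = {X. \<exists>y S. KKT C A b X y S}"

definition Sstar :: "'n::finite mat \<Rightarrow> ('m::finite \<Rightarrow> 'n mat) \<Rightarrow> real^'m \<Rightarrow> 'n mat set" where
  "Sstar C A b = {S. \<exists>X y. KKT C A b X y S}"

definition Zstar :: "real \<Rightarrow> 'n::finite mat \<Rightarrow> ('m::finite \<Rightarrow> 'n mat) \<Rightarrow> real^'m \<Rightarrow> 'n mat set" where
  "Zstar \<sigma> C A b = {X - \<sigma> *\<^sub>R S | X S. X \<in> Xstar C A b \<and> S \<in> Sstar C A b}"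

definition delta1 :: "('m::finite \<Rightarrow> 'n::finite mat) \<Rightarrow> 'n mat \<Rightarrow> 'n mat \<Rightarrow> 'n mat" where
  "delta1 A Z H = - projP A (dir1 proj_plus Z H) - projPperp A (dir1 proj_minus Z H)"

definition delta2 :: "('m::finite \<Rightarrow> 'n::finite mat) \<Rightarrow> 'n mat \<Rightarrow> 'n mat \<Rightarrow> 'n mat \<Rightarrow> 'n mat" where
  "delta2 A Z H W = - projP A (dir2 proj_plus Z H W) - projPperp A (dir2 proj_minus Z H W)"

definition crit :: "('m::finite \<Rightarrow> 'n::finite mat) \<Rightarrow> 'n mat \<Rightarrow> 'n mat set" where
  "crit A Z = {H \<in> Sym. delta1 A Z H = 0}"

definition pinv :: "'n::finite mat \<Rightarrow> 'n mat" where
  "pinv Z = (THE M. Z ** M ** Z = Z \<and> M ** Z ** M = M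
                 \<and> transpose (Z ** M) = Z ** M \<and> transpose (M ** Z) = M ** Z)"

definition kerproj :: "'n::finite mat \<Rightarrow> 'n mat" where
  "kerproj Z = (THE P. transpose P = P \<and> P ** P = P
                 \<and> (\<forall>x. (\<exists>y. x = P *v y) \<longleftrightarrow> Z *v x = 0))"

definition Upsilon :: "'n::finite mat \<Rightarrow> 'n mat \<Rightarrow> 'n mat" where
  "Upsilon Z H = 2 *\<^sub>R (kerproj Z ** H ** pinv Z ** H ** kerproj Z)"

definition Theta :: "'n::finite mat \<Rightarrow> 'n mat \<Rightarrow> 'n mat \<Rightarrow> 'n mat" where
  "Theta Z H V = dir2 proj_plus Z H (V + Upsilon Z H) - dir2 proj_plus Z H (Upsilon Z H)"

definition Theta_perp :: "'n::finite mat \<Rightarrow> 'n mat \<Rightarrow> 'n mat \<Rightarrow> 'n mat" where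
  "Theta_perp Z H V = dir2 proj_minus Z H (V + Upsilon Z H) - dir2 proj_minus Z H (Upsilon Z H)"

definition Psi :: "('m::finite \<Rightarrow> 'n::finite mat) \<Rightarrow> 'n mat \<Rightarrow> 'n mat \<Rightarrow> 'n mat" where
  "Psi A Z H = delta2 A Z H (Upsilon Z H)"

definition coneK :: "('m::finite \<Rightarrow> 'n::finite mat) \<Rightarrow> 'n mat \<Rightarrow> 'n mat \<Rightarrow> 'n mat set" where
  "coneK A Z H = closure {projP A (Theta Z H V) + projPperp A (Theta_perp Z H V) | V. V \<in> Sym}"

definition phi :: "('m::finite \<Rightarrow> 'n::finite mat) \<Rightarrow> 'n mat \<Rightarrow> 'n mat \<Rightarrow> 'n mat" where
  "phi A Z H = Psi A Z H - closest_point (coneK A Z H) (Psi A Z H)"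

end

theory Submission
  imports Defs
begin

text \<open>
  The map \<open>F W = \<Pi>\<^sub>+''(Z; H, W)\<close> exists on the symmetric matrices, is firmly nonexpansive as a limit of
  rescaled projections, satisfies \<open>F W + \<Pi>\<^sub>-''(Z; H, W) = W\<close>, and depends on \<open>W\<close> through a linear term
  and the positively homogeneous term \<open>\<Pi>\<^sub>+'(P\<^sub>0 H P\<^sub>0; P\<^sub>0 (W - \<Upsilon>) P\<^sub>0)\<close>. The existence and this formula come
  from writing \<open>Z + t H + t\<^sup>2/2 W = U D U\<^sup>T + O(t\<^sup>3)\<close> with \<open>U\<close> and \<open>D\<close> quadratic in \<open>t\<close>, \<open>U\<close> orthogonal
  up to \<open>O(t\<^sup>3)\<close> and \<open>D\<close> commuting with \<open>Z\<close>: the coefficients solve equations \<open>[K, Z] = R\<close>, which are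
  solvable modulo the commutant of \<open>Z\<close> because \<open>K \<mapsto> [K, Z]\<close> is self-adjoint.

  The iteration \<open>W \<mapsto> W + \<delta>''(W)\<close> is then firmly nonexpansive, so its increments converge to the element
  of least norm of the closure of its displacements, which is \<open>\<phi>\<close>. Comparing the norms of consecutive
  increments splits this limit into its components along \<open>P\<^sup>\<bottom>\<close> and \<open>P\<close>, the limits of the increments
  of \<open>\<Pi>\<^sub>+''\<close> and \<open>\<Pi>\<^sub>-''\<close>, and homogeneity identifies them with \<open>\<Theta>(\<phi>)\<close> and \<open>\<Theta>\<^sup>\<bottom>(\<phi>)\<close>.
\<close>

section \<open>The cone of positive semidefinite matrices\<close>

text \<open>No eigenvalue decomposition is taken. Eigenvectors of the perturbed matrix need not vary
  regularly where eigenvalues coincide, so the curve is only brought into the commutant of Z, and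
  the spectral projectors of Z come from its pseudoinverse. Nonsmoothness is then confined to the
  kernel of Z: for small t the blocks on the nonzero eigenspaces keep their sign, while the kernel
  block is t times a matrix near \<open>P0 ** H ** P0\<close>. Homogeneity of the projection takes
  out this factor t, so a first derivative at \<open>P0 ** H ** P0\<close> appears at second order.

  In the iteration the displacements need not attain their infimal norm and \<open>W k\<close> may
  be unbounded; only the increments are controlled. Nor is F linear, so a limit of the increments of
  W says little about those of F. This is why the component limits come from norms and are
  identified through averages: \<open>W n\<close> divided by n tends to phi, and the homogeneous map
  \<open>Theta\<close> carries these quotients, up to a vanishing term, to the averaged increments
  of F.\<close>

lemma transpose_add: "transpose (A + B) = transpose A + transpose (B :: 'a::ab_group_add^'n^'m)"
  and transpose_diff: "transpose (A - B) = transpose A - transpose (B :: 'a::ab_group_add^'n^'m)"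
  and transpose_uminus: "transpose (- A) = - transpose (A :: 'a::ab_group_add^'n^'m)"
  and transpose_zero: "transpose (0 :: 'a::ab_group_add^'n^'m) = 0"
  by (simp_all add: transpose_def vec_eq_iff)

lemmas transpose_simps =
  transpose_add transpose_diff transpose_uminus transpose_zero transpose_scalar matrix_transpose_mul

lemma bounded_bilinear_matrix_mult:
  "bounded_bilinear ((**) :: real^'n^'m \<Rightarrow> real^'p^'n \<Rightarrow> real^'p^'m)"
  unfolding bilinear_conv_bounded_bilinear[symmetric]
  by (auto simp: bilinear_def linear_iff matrix_matrix_mult_def vec_eq_iff sum.distrib
      sum_distrib_left algebra_simps)

lemmas matrix_mult_linear_simps =
  bounded_bilinear.add_left[OF bounded_bilinear_matrix_mult]
  bounded_bilinear.add_right[OF bounded_bilinear_matrix_mult]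
  bounded_bilinear.diff_left[OF bounded_bilinear_matrix_mult]
  bounded_bilinear.diff_right[OF bounded_bilinear_matrix_mult]
  bounded_bilinear.minus_left[OF bounded_bilinear_matrix_mult]
  bounded_bilinear.minus_right[OF bounded_bilinear_matrix_mult]
  bounded_bilinear.scaleR_left[OF bounded_bilinear_matrix_mult]
  bounded_bilinear.scaleR_right[OF bounded_bilinear_matrix_mult]
  bounded_bilinear.zero_left[OF bounded_bilinear_matrix_mult]
  bounded_bilinear.zero_right[OF bounded_bilinear_matrix_mult]

lemmas matrix_ring_simps =
  matrix_mult_linear_simps matrix_mul_assoc[symmetric] scaleR_right_distrib scaleR_right_diff_distrib

lemma inner_eq_trace: "A \<bullet> B = trace (transpose A ** B)" for A B :: "real^'n^'m"
proof -
  have "A \<bullet> B = (\<Sum>i\<in>UNIV. \<Sum>j\<in>UNIV. A$i$j * B$i$j)"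
    by (simp add: inner_vec_def)
  also have "\<dots> = (\<Sum>j\<in>UNIV. \<Sum>i\<in>UNIV. A$i$j * B$i$j)"
    by (rule sum.swap)
  finally show ?thesis
    by (simp add: trace_def matrix_matrix_mult_def transpose_def)
qed

lemma inner_mult_left: "(A ** B) \<bullet> C = B \<bullet> (transpose A ** C)"
  for A :: "real^'n^'m" and B :: "real^'p^'n"
  by (simp add: inner_eq_trace matrix_transpose_mul matrix_mul_assoc)

lemma inner_mult_right: "(A ** B) \<bullet> C = A \<bullet> (C ** transpose B)"
  for A :: "real^'n^'m" and B :: "real^'p^'n"
  by (simp add: inner_eq_trace matrix_transpose_mul matrix_mul_assoc)
     (metis matrix_mul_assoc trace_mul_sym)

lemma inner_transpose: "transpose A \<bullet> transpose B = A \<bullet> B" for A B :: "real^'n^'m"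
  by (simp add: inner_eq_trace) (metis matrix_transpose_mul trace_mul_sym transpose_transpose inner_commute inner_eq_trace)

lemma inner_matrix_vector: "x \<bullet> (A *v y) = (transpose A *v x) \<bullet> y" for A :: "real^'n^'m"
  by (simp add: dot_lmul_matrix)

lemma transpose_mult_self_eq_0: "transpose A ** A = 0 \<longleftrightarrow> A = 0" for A :: "real^'n^'m"
proof
  assume "transpose A ** A = 0"
  then have "A \<bullet> A = 0" by (simp add: inner_eq_trace trace_def)
  then show "A = 0" by simp
qed (simp add: matrix_mult_linear_simps)

lemma Sym_iff: "A \<in> Sym \<longleftrightarrow> transpose A = A" by (simp add: Sym_def)

lemma subspace_Sym: "subspace (Sym :: 'n::finite mat set)"
  by (auto simp: subspace_def Sym_iff transpose_simps)

lemma Sym_zero: "0 \<in> Sym" by (simp add: Sym_iff transpose_zero)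
lemma Sym_add: "A \<in> Sym \<Longrightarrow> B \<in> Sym \<Longrightarrow> A + B \<in> Sym" by (simp add: Sym_iff transpose_simps)
lemma Sym_diff: "A \<in> Sym \<Longrightarrow> B \<in> Sym \<Longrightarrow> A - B \<in> Sym" by (simp add: Sym_iff transpose_simps)
lemma Sym_uminus: "A \<in> Sym \<Longrightarrow> - A \<in> Sym" by (simp add: Sym_iff transpose_simps)
lemma Sym_scaleR: "A \<in> Sym \<Longrightarrow> c *\<^sub>R A \<in> Sym" by (simp add: Sym_iff transpose_simps)
lemma Sym_congr: "A \<in> Sym \<Longrightarrow> R ** A ** transpose R \<in> Sym"
  by (simp add: Sym_iff transpose_simps matrix_mul_assoc)

lemma closed_Sym: "closed (Sym :: 'n::finite mat set)"
  using closed_subspace subspace_Sym by blast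

lemma Sym_tendsto:
  assumes "(f \<longlongrightarrow> l) F" "eventually (\<lambda>t. f t \<in> Sym) F" "F \<noteq> bot"
  shows "l \<in> Sym"
  using Lim_in_closed_set[OF closed_Sym] assms by blast

text \<open>Pairing with rank-one matrices recovers the quadratic form. This exhibits the cone as an
  intersection of half-spaces and turns nonnegativity on the cone into positive
  semidefiniteness.\<close>

lemma outer_psd: "(\<chi> i j. x$i * x$j) \<in> PSD" and inner_outer: "(\<chi> i j. x$i * x$j) \<bullet> A = x \<bullet> (A *v x)"
  for x :: "real^'n::finite"
proof -
  have "(\<chi> i j. x$i * x$j) *v y = (x \<bullet> y) *\<^sub>R x" for y
    by (simp add: vec_eq_iff matrix_vector_mult_def inner_vec_def sum_distrib_left algebra_simps)
  then show "(\<chi> i j. x$i * x$j) \<in> PSD"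
    by (simp add: PSD_def Sym_iff inner_commute) (simp add: transpose_def vec_eq_iff mult.commute)
  show "(\<chi> i j. x$i * x$j) \<bullet> A = x \<bullet> (A *v x)"
    by (simp add: inner_vec_def matrix_vector_mult_def sum_distrib_left algebra_simps)
qed

lemma PSD_Sym: "A \<in> PSD \<Longrightarrow> A \<in> Sym" by (simp add: PSD_def)
lemma PSD_zero: "0 \<in> PSD" by (simp add: PSD_def Sym_zero)
lemma PSD_add: "A \<in> PSD \<Longrightarrow> B \<in> PSD \<Longrightarrow> A + B \<in> PSD"
  by (simp add: PSD_def Sym_add algebra_simps inner_add_right)
lemma PSD_scaleR: "A \<in> PSD \<Longrightarrow> c \<ge> 0 \<Longrightarrow> c *\<^sub>R A \<in> PSD"
  by (simp add: PSD_def Sym_scaleR scaleR_matrix_vector_assoc[symmetric])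

lemma PSD_congr:
  assumes "A \<in> PSD"
  shows "R ** A ** transpose R \<in> PSD"
proof -
  have "x \<bullet> (R ** A ** transpose R *v x) = (transpose R *v x) \<bullet> (A *v (transpose R *v x))" for x
    by (simp only: matrix_vector_mul_assoc[symmetric] inner_matrix_vector[of x R])
  then show ?thesis using assms by (simp del: transpose_matrix_vector add: PSD_def Sym_congr)
qed

lemma matrix_vector_mult_uminus: "(- A) *v x = - (A *v x)" for A :: "real^'n^'m"
  by (simp add: matrix_vector_mult_def vec_eq_iff sum_negf)

text \<open>The quadratic form vanishes identically, and by symmetry polarization makes the bilinear
  form vanish too.\<close>

lemma PSD_antisym:
  assumes "A \<in> PSD" "- A \<in> PSD"
  shows "A = 0"
proof -
  have q: "x \<bullet> (A *v x) = 0" for x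
    using assms by (force simp: PSD_def matrix_vector_mult_uminus intro: antisym)
  have sym: "y \<bullet> (A *v x) = x \<bullet> (A *v y)" for x y
    using assms inner_matrix_vector[of y A x] by (simp del: transpose_matrix_vector add: PSD_def Sym_iff inner_commute)
  have "x \<bullet> (A *v y) = 0" for x y
    using q[of "x + y"] q[of x] q[of y] sym[of x y] by (simp add: algebra_simps inner_add_right)
  then have "A *v y = 0" for y by (metis inner_eq_zero_iff)
  then show ?thesis by (simp add: matrix_eq)
qed

lemma convex_PSD: "convex (PSD :: 'n::finite mat set)"
  unfolding convex_def by (auto intro!: PSD_add PSD_scaleR)

lemma closed_PSD: "closed (PSD :: 'n::finite mat set)"
proof -
  have "PSD = Sym \<inter> (\<Inter>x. {M::'n mat. (\<chi> i j. x$i * x$j) \<bullet> M \<ge> 0})"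
    by (auto simp: PSD_def inner_outer)
  also have "closed \<dots>"
    by (intro closed_Int closed_Sym closed_INT closed_halfspace_ge ballI)
  finally show ?thesis .
qed

lemma NSD_eq_uminus: "NSD = uminus ` (PSD :: 'n::finite mat set)"
proof -
  have [simp]: "- A *v x = - (A *v x)" for A :: "'n mat" and x
    by (simp add: matrix_vector_mult_def vec_eq_iff sum_negf)
  show ?thesis
  proof (intro set_eqI iffI)
    fix A :: "'n mat" assume "A \<in> NSD"
    then have "- A \<in> PSD" by (auto simp: NSD_def PSD_def Sym_uminus)
    then show "A \<in> uminus ` PSD" by (metis add.inverse_inverse imageI)
  qed (auto simp: NSD_def PSD_def Sym_uminus)
qed

section \<open>The projection onto the PSD cone and the Moreau decomposition\<close>

lemma proj_plus_PSD: "proj_plus Z \<in> PSD"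
  unfolding proj_plus_def using closest_point_in_set[OF closed_PSD] PSD_zero by blast

lemma proj_plus_dot: "P \<in> PSD \<Longrightarrow> (Z - proj_plus Z) \<bullet> (P - proj_plus Z) \<le> 0"
  unfolding proj_plus_def by (intro closest_point_dot convex_PSD closed_PSD)

lemma proj_plus_unique:
  assumes "Y \<in> PSD" "\<And>P. P \<in> PSD \<Longrightarrow> (Z - Y) \<bullet> (P - Y) \<le> 0"
  shows "proj_plus Z = Y"
proof -
  let ?X = "proj_plus Z"
  have "(Z - Y) \<bullet> (?X - Y) + (Z - ?X) \<bullet> (Y - ?X) \<le> 0"
    using assms(2)[OF proj_plus_PSD, of Z] proj_plus_dot[OF assms(1), of Z] by linarith
  then have "(?X - Y) \<bullet> (?X - Y) \<le> 0"
    by (simp add: algebra_simps inner_commute)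
  then show ?thesis by (simp add: inner_ge_zero order_antisym_conv)
qed

lemma proj_plus_lipschitz: "norm (proj_plus A - proj_plus B) \<le> norm (A - B)"
  using closest_point_lipschitz[OF convex_PSD closed_PSD, of A B] PSD_zero
  by (auto simp: proj_plus_def dist_norm)

text \<open>Moving along the curve of congruences \<open>(1 + s K) X (1 + s K)\<^sup>T\<close>, which stays in the cone,
  turns the scalar complementarity condition into a matrix identity.\<close>
lemma complementary_mult_eq_0:
  assumes X: "X \<in> PSD" and S: "S \<in> Sym" "\<And>P. P \<in> PSD \<Longrightarrow> S \<bullet> P \<ge> 0" and "S \<bullet> X = 0"
  shows "X ** S = 0"
proof -
  define K where "K = S ** X"
  have tX: "transpose X = X" and tS: "transpose S = S"
    using X S by (auto simp: PSD_def Sym_iff)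
  have q: "2 * s * (K \<bullet> K) + s\<^sup>2 * (S \<bullet> (K ** X ** transpose K)) \<ge> 0" for s :: real
  proof -
    let ?R = "mat 1 + s *\<^sub>R K"
    have "0 \<le> S \<bullet> (?R ** X ** transpose ?R)"
      by (intro S PSD_congr X)
    also have "?R ** X ** transpose ?R = X + s *\<^sub>R (K ** X) + s *\<^sub>R (X ** transpose K)
        + s\<^sup>2 *\<^sub>R (K ** X ** transpose K)"
      by (simp add: transpose_simps matrix_ring_simps power2_eq_square)
    also have "S \<bullet> \<dots> = s * (S \<bullet> (K ** X)) + s * (S \<bullet> (X ** transpose K)) + s\<^sup>2 * (S \<bullet> (K ** X ** transpose K))"
      using assms(4) by (simp add: inner_add_right)
    also have "S \<bullet> (K ** X) = K \<bullet> K"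
      using inner_mult_right[of K X S] tX by (simp add: inner_commute K_def)
    also have "S \<bullet> (X ** transpose K) = K \<bullet> K"
      using inner_mult_left[of X "transpose K" S] tX inner_transpose[of K K] tS
      by (simp add: inner_commute K_def matrix_transpose_mul)
    finally show ?thesis by simp
  qed
  have "K \<bullet> K = 0"
  proof (rule ccontr)
    assume "K \<bullet> K \<noteq> 0"
    then have a: "K \<bullet> K > 0" by simp
    define c where "c = S \<bullet> (K ** X ** transpose K)"
    \<comment> \<open>The polynomial in \<open>q\<close> has slope
      \<open>2 * (K \<bullet> K)\<close> at 0, so a small negative s makes it negative. The size of
      s keeps the quadratic term below the linear one, and the 1 guards against c = 0.\<close>
    define s where "s = - (K \<bullet> K) / (\<bar>c\<bar> + 1)"
    have s: "s < 0" using a by (auto simp: s_def divide_simps)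
    have "- s * c \<le> \<bar>s\<bar> * \<bar>c\<bar>" by (simp add: abs_mult[symmetric])
    also have "\<dots> \<le> K \<bullet> K" using a by (auto simp: s_def field_simps)
    finally have "2 * (K \<bullet> K) + s * c > 0" using a by linarith
    then have "s * (2 * (K \<bullet> K) + s * c) < 0" using s by (simp add: mult_neg_pos)
    then show False using q[of s] by (simp add: c_def algebra_simps power2_eq_square)
  qed
  then have "S ** X = 0" by (simp add: K_def)
  then have "transpose (S ** X) = 0" by (simp add: transpose_zero)
  then show ?thesis by (simp add: matrix_transpose_mul tX tS)
qed

text \<open>Testing the variational inequality at 0 and at \<open>2 *\<^sub>R X\<close> gives
  orthogonality of S and X. Hence S is nonnegative on the whole cone, and outer products show that
  it lies in the cone itself.\<close>

lemma proj_plus_moreau: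
  fixes Z :: "'n::finite mat"
  assumes "Z \<in> Sym"
  defines "X \<equiv> proj_plus Z" defines "S \<equiv> X - Z"
  shows "X \<in> PSD" "S \<in> PSD" "X ** S = 0"
proof -
  show X: "X \<in> PSD" by (simp add: X_def proj_plus_PSD)
  have vi: "S \<bullet> (P - X) \<ge> 0" if "P \<in> PSD" for P
    using proj_plus_dot[OF that, of Z] by (simp add: S_def X_def algebra_simps)
  have SX: "S \<bullet> X = 0"
    using vi[OF PSD_zero] vi[OF PSD_scaleR[OF X, of 2]] by (simp add: algebra_simps)
  have dual: "S \<bullet> P \<ge> 0" if "P \<in> PSD" for P
    using vi[OF that] SX by (simp add: algebra_simps)
  have Sym: "S \<in> Sym" using X assms by (auto simp: S_def intro: Sym_diff PSD_Sym)
  then show "S \<in> PSD"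
    using dual[OF outer_psd] by (simp add: PSD_def) (metis inner_commute inner_outer)
  show "X ** S = 0"
    by (rule complementary_mult_eq_0[OF X Sym dual SX])
qed

text \<open>The projection \<open>X\<close> of \<open>- P\<close> satisfies \<open>X\<^sup>2 = - X P\<close>, whence \<open>X P X = - X\<^sup>3\<close> is both
  positive and negative semidefinite, so \<open>X = 0\<close>.\<close>
lemma inner_PSD_nonneg:
  assumes P: "P \<in> PSD" and Q: "Q \<in> PSD"
  shows "P \<bullet> Q \<ge> 0"
proof -
  define X where "X = proj_plus (- P)"
  have X: "X \<in> PSD" and XR: "X ** (X + P) = 0"
    using proj_plus_moreau[of "- P"] P by (auto simp: X_def PSD_Sym Sym_uminus)
  have tX: "transpose X = X" using X by (simp add: PSD_def Sym_iff)
  have XP: "X ** P = - (X ** X)" using XR by (simp add: matrix_ring_simps add_eq_0_iff2)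
  have 1: "X ** P ** transpose X \<in> PSD" "X ** X ** transpose X \<in> PSD"
    by (intro PSD_congr P X)+
  have e: "X ** P ** transpose X = - (X ** X ** transpose X)"
    by (simp add: XP matrix_mult_linear_simps)
  have "X ** X ** transpose X = 0"
    by (rule PSD_antisym) (use 1 in \<open>simp_all add: e\<close>)
  then have "transpose (X ** X) ** (X ** X) = 0"
    by (simp add: tX transpose_simps) (simp add: matrix_mul_assoc matrix_mult_linear_simps)
  then have "X ** X = 0" by (simp only: transpose_mult_self_eq_0)
  then have "X = 0" using transpose_mult_self_eq_0[of X] tX by simp
  then have "- P \<bullet> Q \<le> 0" using proj_plus_dot[OF Q, of "- P"] by (simp add: X_def)
  then show ?thesis by simp
qed

text \<open>A stable form of the uniqueness of the Moreau decomposition: a difference of two cone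
  elements that are only nearly orthogonal still determines the projection, with an error governed
  by the defect. Expanding \<open>(X - Y) \<bullet> (R - S)\<close>, the term with X and R vanishes
  and the two mixed terms have the favourable sign.\<close>

lemma norm_proj_plus_diff_le:
  assumes Y: "Y \<in> PSD" and S: "S \<in> PSD"
  shows "(norm (proj_plus (Y - S) - Y))\<^sup>2 \<le> Y \<bullet> S"
proof -
  define X where "X = proj_plus (Y - S)"
  define R where "R = X - (Y - S)"
  have "Y - S \<in> Sym" using Y S by (intro Sym_diff PSD_Sym)
  note m = proj_plus_moreau[OF this, folded X_def, folded R_def]
  have "X \<bullet> R = 0"
  proof -
    have "X \<bullet> R = trace (X ** R)" using m(1) by (simp add: inner_eq_trace PSD_def Sym_iff)
    then show ?thesis using m(3) by (simp add: trace_def)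
  qed
  moreover have "X \<bullet> S \<ge> 0" "Y \<bullet> R \<ge> 0" using m Y S by (auto intro: inner_PSD_nonneg)
  moreover have "(norm (X - Y))\<^sup>2 = (X - Y) \<bullet> (R - S)"
    by (simp add: R_def power2_norm_eq_inner)
  ultimately show ?thesis by (simp add: X_def algebra_simps)
qed

lemma proj_plus_eqI:
  assumes "Y \<in> PSD" "S \<in> PSD" "Y \<bullet> S = 0" "Z = Y - S"
  shows "proj_plus Z = Y"
  using norm_proj_plus_diff_le[OF assms(1,2)] assms(3,4) by simp

lemma proj_plus_self: "Z \<in> PSD \<Longrightarrow> proj_plus Z = Z"
  by (rule proj_plus_eqI[of Z 0]) (auto simp: PSD_zero)

lemma proj_plus_scaleR:
  assumes "c \<ge> 0"
  shows "proj_plus (c *\<^sub>R Z) = c *\<^sub>R proj_plus Z"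
proof (cases "c = 0")
  case True then show ?thesis by (simp add: proj_plus_self PSD_zero)
next
  case False
  with assms have c: "c > 0" by simp
  show ?thesis
  proof (rule proj_plus_unique)
    fix P :: "real^'a^'a" assume "P \<in> PSD"
    then have "(1/c) *\<^sub>R P \<in> PSD" using c by (simp add: PSD_scaleR)
    from proj_plus_dot[OF this, of Z]
    have "c^2 * ((Z - proj_plus Z) \<bullet> ((1/c) *\<^sub>R P - proj_plus Z)) \<le> 0"
      using c by (simp add: mult_nonneg_nonpos)
    also have "c^2 * ((Z - proj_plus Z) \<bullet> ((1/c) *\<^sub>R P - proj_plus Z))
      = (c *\<^sub>R (Z - proj_plus Z)) \<bullet> (c *\<^sub>R ((1/c) *\<^sub>R P - proj_plus Z))"
      by (simp add: power2_eq_square)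
    also have "c *\<^sub>R ((1/c) *\<^sub>R P - proj_plus Z) = P - c *\<^sub>R proj_plus Z"
      using c by (simp add: scaleR_right_diff_distrib)
    finally show "(c *\<^sub>R Z - c *\<^sub>R proj_plus Z) \<bullet> (P - c *\<^sub>R proj_plus Z) \<le> 0"
      by (simp add: scaleR_right_diff_distrib)
  qed (use assms in \<open>auto intro: PSD_scaleR proj_plus_PSD\<close>)
qed

text \<open>Reflection reduces this to the PSD cone: the Moreau pair of \<open>- Z\<close> is that
  of Z with its two members exchanged.\<close>

lemma proj_minus_eq:
  assumes "Z \<in> Sym"
  shows "proj_minus Z = Z - proj_plus Z"
proof -
  let ?S = "proj_plus Z - Z"
  note m = proj_plus_moreau[OF assms]
  have "?S \<bullet> proj_plus Z = 0"
  proof -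
    have "proj_plus Z \<bullet> ?S = trace (proj_plus Z ** ?S)" using m(1) by (simp add: inner_eq_trace PSD_def Sym_iff)
    then show ?thesis using m(3) by (simp add: trace_def inner_commute)
  qed
  then have p: "proj_plus (- Z) = ?S"
    using m by (intro proj_plus_eqI[of _ "proj_plus Z"]) auto
  have "closed (NSD :: 'a mat set)" "convex (NSD :: 'a mat set)"
    unfolding NSD_eq_uminus by (auto intro: closed_negations closed_PSD convex_negations convex_PSD)
  moreover have "\<forall>M\<in>NSD. dist Z (- ?S) \<le> dist Z M"
  proof
    fix M :: "'a mat" assume "M \<in> NSD"
    then obtain P where P: "P \<in> PSD" "M = - P" by (auto simp: NSD_eq_uminus)
    have "dist (- Z) ?S \<le> dist (- Z) P"
      using closest_point_le[OF closed_PSD P(1), of "- Z"] p by (simp add: proj_plus_def)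
    then show "dist Z (- ?S) \<le> dist Z M"
      by (metis P(2) add.inverse_inverse dist_minus)
  qed
  moreover have "- ?S \<in> NSD" using m(2) unfolding NSD_eq_uminus by (rule imageI)
  ultimately have "- ?S = closest_point NSD Z" by (intro closest_point_unique)
  then show ?thesis by (simp add: proj_minus_def)
qed

section \<open>Block diagonalization of symmetric perturbations\<close>

text \<open>The orthogonal complement of the range of f is its kernel, so f and its square have the
  same range and a right inverse of the square can be used. This replaces diagonalization twice: for
  multiplication by Z and for the commutator with Z.\<close>

lemma selfadjoint_generalized_inverse:
  fixes f :: "'a::euclidean_space \<Rightarrow> 'a"
  assumes f: "linear f" and sa: "\<And>x y. f x \<bullet> y = x \<bullet> f y"
  shows "\<exists>g. linear g \<and> (\<forall>y. f (f (g y)) = f y)"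
proof -
  have h: "linear (f \<circ> f)" using f by (intro linear_compose)
  obtain r where r: "linear r" "\<forall>z\<in>range (f \<circ> f). (f \<circ> f) (r z) = z"
    using linear_exists_right_inverse_on[OF h subspace_UNIV] by auto
  have "f y \<in> range (f \<circ> f)" for y
  proof -
    obtain a b where ab: "a \<in> span (range f)" "\<And>w. w \<in> span (range f) \<Longrightarrow> orthogonal b w" "y = a + b"
      using orthogonal_subspace_decomp_exists[of "range f" y] by metis
    have "b \<bullet> f (f b) = 0" using ab(2)[of "f (f b)"] by (simp add: span_base orthogonal_def)
    then have "f b = 0" using sa[of b "f b"] by simp
    moreover have "span (range f) = range f"
      using linear_subspace_image[OF f subspace_UNIV] by (simp only: span_eq_iff)
    then obtain c where "a = f c" using ab(1) by (metis imageE)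
    ultimately have "f y = (f \<circ> f) c" using ab(3) f by (simp add: linear_add)
    then show ?thesis by blast
  qed
  then have "f (f ((r \<circ> f) y)) = f y" for y
    using bspec[OF r(2), of "f y"] by simp
  then have "linear (r \<circ> f) \<and> (\<forall>y. f (f ((r \<circ> f) y)) = f y)"
    using linear_compose[OF f r(1)] by blast
  then show ?thesis by blast
qed

text \<open>The two \<open>THE\<close> descriptions say something only after existence and
  uniqueness are shown. Both objects are built from one matrix G with
  \<open>Z ** (Z ** G) = Z\<close>.\<close>

lemma pinv_kerproj:
  fixes Z :: "'n::finite mat"
  assumes Z: "Z \<in> Sym"
  shows "transpose (kerproj Z) = kerproj Z" "kerproj Z ** kerproj Z = kerproj Z"
    "Z ** kerproj Z = 0" "kerproj Z ** Z = 0" "transpose (pinv Z) = pinv Z"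
    "Z ** pinv Z = mat 1 - kerproj Z" "pinv Z ** Z = mat 1 - kerproj Z"
    "pinv Z ** kerproj Z = 0" "kerproj Z ** pinv Z = 0"
proof -
  have tZ: "transpose Z = Z" using Z by (simp add: Sym_iff)
  have "(Z *v x) \<bullet> y = x \<bullet> (Z *v y)" for x y
    using inner_matrix_vector[of x Z y] tZ by (simp del: transpose_matrix_vector)
  then obtain g where g: "linear g" "\<And>y. Z *v (Z *v g y) = Z *v y"
    using selfadjoint_generalized_inverse[of "(*v) Z"] by auto
  define G where "G = matrix g"
  have "g = (*v) G" using g(1) by (simp add: G_def matrix_works fun_eq_iff)
  with g(2) have ZZG: "Z ** (Z ** G) = Z"
    by (simp add: matrix_eq matrix_vector_mul_assoc matrix_mul_assoc)
  have ZZG': "Z ** (Z ** (G ** A)) = Z ** A" for A :: "'n mat" using ZZG by (metis matrix_mul_assoc)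
  define P where "P = mat 1 - Z ** G"
  have ZP: "Z ** P = 0" by (simp add: P_def matrix_ring_simps ZZG)
  have "transpose P ** P = transpose P"
  proof -
    have "transpose P ** Z = transpose (Z ** P)" by (simp add: matrix_transpose_mul tZ)
    then have "transpose P ** Z = 0" by (simp add: ZP transpose_zero)
    then have "transpose P ** (Z ** G) = 0" by (simp add: matrix_mul_assoc matrix_mult_linear_simps)
    then show ?thesis by (simp add: P_def matrix_ring_simps)
  qed
  \<comment> \<open>The product \<open>transpose P ** P\<close> is symmetric, hence so is
    \<open>transpose P\<close>.\<close>
  then have tP: "transpose P = P"
    by (metis matrix_transpose_mul transpose_transpose)
  with \<open>transpose P ** P = transpose P\<close> have PP: "P ** P = P" by simp
  have PZ: "P ** Z = 0"
    using arg_cong[OF ZP, of transpose] by (simp add: matrix_transpose_mul tZ tP transpose_zero)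
  have "kerproj Z = P"
    unfolding kerproj_def
  proof (rule the_equality)
    have "Z *v x = 0 \<Longrightarrow> P *v x = x" for x
    proof -
      assume "Z *v x = 0"
      have "transpose P = mat 1 - transpose G ** Z" by (simp add: P_def transpose_simps tZ)
      then have "P = mat 1 - transpose G ** Z" by (simp only: tP)
      then show "P *v x = x"
        using \<open>Z *v x = 0\<close> by (simp add: matrix_vector_mult_diff_rdistrib flip: matrix_vector_mul_assoc)
    qed
    moreover have "Z *v (P *v y) = 0" for y using ZP by (simp add: matrix_vector_mul_assoc)
    ultimately show *: "transpose P = P \<and> P ** P = P \<and> (\<forall>x. (\<exists>y. x = P *v y) = (Z *v x = 0))"
      using tP PP by metis
    fix Q assume Q: "transpose Q = Q \<and> Q ** Q = Q \<and> (\<forall>x. (\<exists>y. x = Q *v y) = (Z *v x = 0))"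
    have 1: "P ** R = R" if "\<forall>x. Z *v (R *v x) = 0" for R
      using that * PP by (metis matrix_eq matrix_vector_mul_assoc)
    have 2: "Q ** R = R" if "\<forall>x. Z *v (R *v x) = 0" for R
      using that Q by (metis matrix_eq matrix_vector_mul_assoc)
    have "P ** Q = Q" using Q by (intro 1) blast
    moreover have "Q ** P = P" using * by (intro 2) blast
    ultimately show "Q = P"
      using tP Q by (metis matrix_transpose_mul)
  qed
  note K = this
  have ZG: "Z ** G = mat 1 - P" by (simp add: P_def)
  have GZ: "transpose G ** Z = mat 1 - P"
    using arg_cong[OF ZG, of transpose] by (simp add: transpose_simps tZ tP)
  \<comment> \<open>G inverts Z only on one side and is arbitrary on the kernel; compressing it to
    the range of Z repairs both.\<close>
  define N where "N = (mat 1 - P) ** G ** (mat 1 - P)"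
  have ZN: "Z ** N = mat 1 - P"
  proof -
    have "Z ** N = (Z ** (mat 1 - P)) ** G ** (mat 1 - P)" by (simp add: N_def matrix_mul_assoc)
    also have "Z ** (mat 1 - P) = Z" by (simp add: matrix_ring_simps ZP)
    finally show ?thesis by (simp add: ZG matrix_ring_simps PP)
  qed
  have NZ: "N ** Z = mat 1 - P"
  proof -
    have "N ** Z = (mat 1 - P) ** (G ** ((mat 1 - P) ** Z))" by (simp add: N_def matrix_mul_assoc)
    also have "(mat 1 - P) ** Z = Z" by (simp add: matrix_ring_simps PZ)
    also have "(mat 1 - P) ** (G ** Z) = transpose G ** ((Z ** G) ** Z)"
      by (simp add: matrix_mul_assoc GZ)
    also have "\<dots> = mat 1 - P" by (simp add: ZG GZ matrix_ring_simps PZ)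
    finally show ?thesis .
  qed
  have NP: "N ** P = 0" and PN: "P ** N = 0" by (simp_all add: N_def matrix_ring_simps PP)
     (simp_all add: matrix_mul_assoc PP)
  have "pinv Z = N"
    unfolding pinv_def
  proof (rule the_equality)
    show "Z ** N ** Z = Z \<and> N ** Z ** N = N \<and> transpose (Z ** N) = Z ** N \<and> transpose (N ** Z) = N ** Z"
      by (simp add: ZN NZ transpose_simps tP matrix_ring_simps PZ PN)
    fix M assume M: "Z ** M ** Z = Z \<and> M ** Z ** M = M \<and> transpose (Z ** M) = Z ** M \<and> transpose (M ** Z) = M ** Z"
    have a: "(mat 1 - P) ** (Z ** M) = Z ** M" by (simp add: matrix_ring_simps) (simp add: matrix_mul_assoc PZ matrix_mult_linear_simps)
    have "Z ** M ** (mat 1 - P) = mat 1 - P"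
      using M ZN by (metis matrix_mul_assoc)
    then have "transpose (Z ** M ** (mat 1 - P)) = mat 1 - P" by (simp add: transpose_simps tP)
    then have "(mat 1 - P) ** (Z ** M) = mat 1 - P" using M by (simp add: transpose_simps tP)
    with a have ZM: "Z ** M = mat 1 - P" by simp
    have b: "(M ** Z) ** (mat 1 - P) = M ** Z" by (simp add: matrix_ring_simps ZP)
    have "(mat 1 - P) ** (M ** Z) = mat 1 - P"
      using M NZ by (metis matrix_mul_assoc)
    then have "transpose ((mat 1 - P) ** (M ** Z)) = mat 1 - P" by (simp add: transpose_simps tP)
    then have "(M ** Z) ** (mat 1 - P) = mat 1 - P" using M by (simp add: transpose_simps tP)
    with b have MZ: "M ** Z = mat 1 - P" by simp
    have "M = M ** Z ** M" using M by simp
    also have "\<dots> = N ** Z ** M" by (simp add: MZ NZ)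
    also have "\<dots> = N ** (mat 1 - P)" by (simp add: ZM flip: matrix_mul_assoc)
    also have "\<dots> = N" by (simp add: matrix_ring_simps NP)
    finally show "M = N" .
  qed
  moreover have "transpose N = N"
  proof -
    have "transpose N = transpose N ** (mat 1 - P)"
      using arg_cong[OF PN, of transpose] by (simp add: transpose_simps tP matrix_ring_simps transpose_zero)
    also have "\<dots> = (transpose N ** Z) ** N" by (simp add: ZN flip: matrix_mul_assoc)
    also have "transpose N ** Z = mat 1 - P"
      using arg_cong[OF ZN, of transpose] by (simp add: transpose_simps tZ tP)
    finally show ?thesis by (simp add: matrix_ring_simps PN)
  qed
  ultimately show "transpose (kerproj Z) = kerproj Z" "kerproj Z ** kerproj Z = kerproj Z"
    "Z ** kerproj Z = 0" "kerproj Z ** Z = 0" "transpose (pinv Z) = pinv Z"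
    "Z ** pinv Z = mat 1 - kerproj Z" "pinv Z ** Z = mat 1 - kerproj Z"
    "pinv Z ** kerproj Z = 0" "kerproj Z ** pinv Z = 0"
    using K tP PP ZP PZ ZN NZ NP PN by simp_all
qed

text \<open>The commutator with Z is self-adjoint for the trace inner product, so its generalized
  inverse leaves a remainder that commutes with Z. Skewness of \<open>k W\<close> makes the later
  congruences orthogonal to leading order, and the vanishing kernel block makes the second-order
  kernel term computable.\<close>

lemma Sym_commutator_decomposition:
  fixes Z P :: "'n::finite mat"
  assumes Z: "Z \<in> Sym" and P: "P ** P = P" "transpose P = P" "Z ** P = 0" "P ** Z = 0"
  shows "\<exists>k. linear k \<and> (\<forall>W\<in>Sym. transpose (k W) = - k W \<and> P ** k W ** P = 0 \<and>
      (W - (k W ** Z - Z ** k W)) ** Z = Z ** (W - (k W ** Z - Z ** k W)))"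
proof -
  have tZ: "transpose Z = Z" using Z by (simp add: Sym_iff)
  define f where "f M = M ** Z - Z ** M" for M :: "'n mat"
  have lf: "linear f" by (auto simp: linear_iff f_def matrix_mult_linear_simps algebra_simps)
  have "f M \<bullet> Y = M \<bullet> f Y" for M Y
    using inner_mult_right[of M Z Y] inner_mult_left[of Z M Y] tZ
    by (simp add: f_def inner_diff_left inner_diff_right)
  then obtain g where g: "linear g" "\<And>y. f (f (g y)) = f y"
    using selfadjoint_generalized_inverse[OF lf] by auto
  have tf: "transpose (f M) = - f (transpose M)" for M by (simp add: f_def transpose_simps tZ)
  \<comment> \<open>For symmetric W, passing to the skew part replaces the remainder
    \<open>W - f (g W)\<close> by its symmetric part, which still commutes with Z. Removing the
    kernel block afterwards is free, since \<open>P ** M ** P\<close> commutes with Z.\<close>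
  define s where "s W = (1/2) *\<^sub>R (g W - transpose (g W))" for W
  define k where "k W = s W - P ** s W ** P" for W
  have "linear k"
    using g(1) by (auto simp: linear_iff k_def s_def matrix_mult_linear_simps transpose_simps algebra_simps)
  moreover have "transpose (k W) = - k W" for W
    by (simp add: k_def s_def transpose_simps P matrix_ring_simps)
  moreover have "P ** k W ** P = 0" for W
  proof -
    have "P ** (P ** A) = P ** A" for A :: "'n mat" by (simp add: matrix_mul_assoc P)
    then show ?thesis by (simp add: k_def matrix_ring_simps P)
  qed
  moreover have "f (W - f (k W)) = 0" if "W \<in> Sym" for W
  proof -
    have "f (P ** M ** P) = 0" for M
      by (simp add: f_def matrix_ring_simps P) (simp add: matrix_mul_assoc P matrix_mult_linear_simps)
    then have "f (k W) = f (s W)" using lf by (simp add: k_def linear_diff)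
    also have "\<dots> = (1/2) *\<^sub>R (f (g W) + transpose (f (g W)))"
      using lf by (simp add: s_def linear_diff linear_cmul tf)
    finally have fk: "f (k W) = \<dots>" .
    let ?G = "W - f (g W)"
    have "f ?G = 0" using lf g(2)[of W] by (simp add: linear_diff)
    moreover from this have "f (transpose ?G) = 0" using tf[of ?G] by (simp add: transpose_zero)
    moreover have "W - f (k W) = (1/2) *\<^sub>R (?G + transpose ?G)"
      using that by (simp add: fk transpose_simps Sym_iff) (simp add: vec_eq_iff field_simps)
    ultimately show ?thesis using lf by (simp add: linear_add linear_cmul)
  qed
  ultimately show ?thesis unfolding f_def by (intro exI[of _ k]) simp
qed

lemma bounded_bilinear_matrix_vector_mult:
  "bounded_bilinear ((*v) :: real^'n^'m \<Rightarrow> real^'n \<Rightarrow> real^'m)"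
  unfolding bilinear_conv_bounded_bilinear[symmetric]
  by (auto simp: bilinear_def linear_iff algebra_simps simp flip: scaleR_matrix_vector_assoc)

text \<open>An eigenvalue bound without eigenvalues: c dominates the operator norm of X, and the
  form is evaluated at the gradient step \<open>x - (1/c) *\<^sub>R (X *v x)\<close>, where it is
  still nonnegative.\<close>

lemma PSD_norm_square_le:
  fixes X :: "'n::finite mat"
  assumes "X \<in> PSD"
  shows "\<exists>c>0. \<forall>x. (norm (X *v x))\<^sup>2 \<le> c * (x \<bullet> (X *v x))"
proof -
  obtain K where K: "K > 0" "\<And>(A::'n mat) x. norm (A *v x) \<le> norm A * norm x * K"
    using bounded_bilinear.pos_bounded[OF bounded_bilinear_matrix_vector_mult] by blast
  define c where "c = norm X * K + 1"
  have c: "c > 0" using K(1) by (simp add: c_def add_nonneg_pos)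
  have sym: "x \<bullet> (X *v y) = (X *v x) \<bullet> y" for x y
    using inner_matrix_vector[of x X y] assms by (simp del: transpose_matrix_vector add: PSD_def Sym_iff)
  have "(norm (X *v x))\<^sup>2 \<le> c * (x \<bullet> (X *v x))" for x
  proof -
    let ?y = "X *v x"
    let ?z = "x - (1/c) *\<^sub>R ?y"
    have b: "?y \<bullet> (X *v ?y) \<le> c * (?y \<bullet> ?y)"
    proof -
      have "?y \<bullet> (X *v ?y) \<le> norm ?y * norm (X *v ?y)" by (rule norm_cauchy_schwarz)
      also have "\<dots> \<le> norm ?y * (norm X * norm ?y * K)" by (intro mult_left_mono K) simp
      also have "\<dots> \<le> c * (?y \<bullet> ?y)" by (simp add: c_def algebra_simps power2_norm_eq_inner[symmetric] power2_eq_square)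
      finally show ?thesis .
    qed
    have xy: "x \<bullet> (X *v ?y) = ?y \<bullet> ?y" by (rule sym)
    have "0 \<le> ?z \<bullet> (X *v ?z)" using assms by (simp add: PSD_def)
    also have "\<dots> = x \<bullet> ?y - 2 / c * (?y \<bullet> ?y) + (1/c)\<^sup>2 * (?y \<bullet> (X *v ?y))"
      by (simp add: matrix_vector_mult_diff_distrib matrix_vector_mult_scaleR inner_diff_left inner_diff_right xy power2_eq_square)
        (simp add: diff_divide_distrib)
    also have "(1/c)\<^sup>2 * (?y \<bullet> (X *v ?y)) \<le> (1/c)\<^sup>2 * (c * (?y \<bullet> ?y))"
      by (intro mult_left_mono b) simp
    also have "\<dots> = 1/c * (?y \<bullet> ?y)" using c by (simp add: power2_eq_square)
    finally have "1/c * (?y \<bullet> ?y) \<le> x \<bullet> ?y" by simp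
    then show ?thesis using c by (simp add: power2_norm_eq_inner field_simps)
  qed
  with c show ?thesis by blast
qed

text \<open>X may be singular, so a general small perturbation leaves the cone. Here E factors
  through X, hence the perturbing form is bounded by a multiple of the squared norm of
  \<open>X *v x\<close>, and so by the form of X itself. The choice of epsilon makes the total
  constant equal to 1.\<close>

lemma PSD_perturbation:
  fixes X N E :: "'n::finite mat"
  assumes X: "X \<in> PSD" and E: "transpose E = E" "E = N ** X"
  shows "\<exists>\<epsilon>>0. \<forall>R\<in>Sym. norm R \<le> \<epsilon> \<longrightarrow> X + E ** R ** E \<in> PSD"
proof -
  obtain K where K: "K > 0" "\<And>(A::'n mat) x. norm (A *v x) \<le> norm A * norm x * K"
    using bounded_bilinear.pos_bounded[OF bounded_bilinear_matrix_vector_mult] by blast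
  obtain c where c: "c > 0" "\<And>x. (norm (X *v x))\<^sup>2 \<le> c * (x \<bullet> (X *v x))"
    using PSD_norm_square_le[OF X] by blast
  define n where "n = norm N * K + 1"
  have n: "n > 0" using K(1) by (simp add: n_def add_nonneg_pos)
  define \<epsilon> where "\<epsilon> = 1 / (K * n\<^sup>2 * c)"
  have eps: "\<epsilon> > 0" using K n c by (simp add: \<epsilon>_def)
  have "X + E ** R ** E \<in> PSD" if R: "R \<in> Sym" "norm R \<le> \<epsilon>" for R
  proof -
    have "X + E ** R ** E \<in> Sym"
      using Sym_add[OF PSD_Sym[OF X] Sym_congr[OF R(1), of E]] E(1) by simp
    moreover have "x \<bullet> ((X + E ** R ** E) *v x) \<ge> 0" for x
    proof -
      have "norm (E *v x) \<le> norm N * norm (X *v x) * K"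
        using K(2)[of N "X *v x"] by (simp add: E(2) matrix_vector_mul_assoc)
      also have "\<dots> \<le> n * norm (X *v x)" by (simp add: n_def algebra_simps)
      finally have "(norm (E *v x))\<^sup>2 \<le> n\<^sup>2 * (norm (X *v x))\<^sup>2"
        by (metis norm_ge_zero power_mono power_mult_distrib)
      also have "\<dots> \<le> n\<^sup>2 * (c * (x \<bullet> (X *v x)))" by (intro mult_left_mono c) simp
      finally have 1: "(norm (E *v x))\<^sup>2 \<le> n\<^sup>2 * c * (x \<bullet> (X *v x))" by simp
      have "\<bar>(E *v x) \<bullet> (R *v (E *v x))\<bar> \<le> norm (E *v x) * norm (R *v (E *v x))"
        by (rule Cauchy_Schwarz_ineq2)
      also have "\<dots> \<le> norm (E *v x) * (norm R * norm (E *v x) * K)" by (intro mult_left_mono K) simp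
      also have "\<dots> = norm R * (K * (norm (E *v x))\<^sup>2)" by (simp add: power2_eq_square)
      also have "\<dots> \<le> \<epsilon> * (K * (n\<^sup>2 * c * (x \<bullet> (X *v x))))"
        using 1 K(1) R(2) eps by (intro mult_mono mult_left_mono) auto
      also have "\<dots> = x \<bullet> (X *v x)" using K n c by (simp add: \<epsilon>_def)
      finally have "x \<bullet> (X *v x) + (E *v x) \<bullet> (R *v (E *v x)) \<ge> 0" by linarith
      moreover have "(E *v x) \<bullet> (R *v (E *v x)) = x \<bullet> ((E ** R ** E) *v x)"
        using inner_matrix_vector[of x E "R *v (E *v x)"] E(1)
        by (simp del: transpose_matrix_vector add: matrix_vector_mul_assoc matrix_mul_assoc)
      ultimately show ?thesis by (simp add: matrix_vector_mult_add_rdistrib inner_add_right)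
    qed
    ultimately show ?thesis by (simp add: PSD_def)
  qed
  with eps show ?thesis by blast
qed

section \<open>Spectral projectors and the commutant of a symmetric matrix\<close>

locale symmetric_matrix =
  fixes Z :: "'n::finite mat"
  assumes Z_Sym: "Z \<in> Sym"
begin

abbreviation P0 :: "'n mat" where "P0 \<equiv> kerproj Z"
abbreviation N :: "'n mat" where "N \<equiv> pinv Z"
definition X :: "'n mat" where "X = proj_plus Z"
definition S :: "'n mat" where "S = X - Z"

text \<open>The spectral projectors onto the positive and the negative eigenspaces of \<open>Z\<close>.\<close>
definition Ep :: "'n mat" where "Ep = N ** X"
definition Em :: "'n mat" where "Em = - (N ** S)"

lemmas P0 = pinv_kerproj[OF Z_Sym]

lemma mult_Z: "A ** Z = A ** X - A ** S" and Z_mult: "Z ** B = X ** B - S ** B"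
  by (simp_all add: S_def matrix_mult_linear_simps)

lemma X_PSD: "X \<in> PSD" and S_PSD: "S \<in> PSD" and XS: "X ** S = 0"
  using proj_plus_moreau[OF Z_Sym] by (simp_all add: X_def S_def)

lemma tZ: "transpose Z = Z" and tX: "transpose X = X" and tS: "transpose S = S"
  using X_PSD S_PSD Z_Sym by (simp_all add: PSD_def Sym_iff)

lemma SX: "S ** X = 0"
  using arg_cong[OF XS, of transpose] by (simp add: transpose_simps tX tS)

lemma XZ: "X ** Z = X ** X" and ZX: "Z ** X = X ** X"
  and ZS: "Z ** S = - (S ** S)"
  by (simp_all add: mult_Z Z_mult matrix_mult_linear_simps XS SX)

lemma XP0: "X ** P0 = 0"
proof -
  have "transpose (X ** P0) ** (X ** P0) = P0 ** X ** X ** P0"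
    by (simp add: transpose_simps tX P0 matrix_mul_assoc)
  also have "\<dots> = P0 ** (X ** X) ** P0" by (simp add: matrix_mul_assoc)
  also have "\<dots> = P0 ** X ** (Z ** P0)" by (simp only: XZ[symmetric] matrix_mul_assoc)
  finally show ?thesis by (simp add: P0 matrix_mult_linear_simps transpose_mult_self_eq_0)
qed

lemma P0X: "P0 ** X = 0"
  using arg_cong[OF XP0, of transpose] by (simp add: transpose_simps tX P0)

lemma P0S: "P0 ** S = 0" by (simp add: S_def matrix_mult_linear_simps P0X P0)

text \<open>M preserves the kernel of Z, so \<open>M ** P0 = P0 ** M ** P0\<close>; the right side
  is symmetric.\<close>

lemma commute_P0:
  assumes M: "M \<in> Sym" and c: "M ** Z = Z ** M"
  shows "M ** P0 = P0 ** M"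
proof -
  have tM: "transpose M = M" using M by (simp add: Sym_iff)
  have "Z ** (M ** P0) = 0"
    using c P0(3) by (metis matrix_mul_assoc matrix_mult_linear_simps(10))
  then have "N ** Z ** (M ** P0) = 0"
    by (simp add: matrix_mult_linear_simps flip: matrix_mul_assoc)
  then have MP: "M ** P0 = P0 ** (M ** P0)" by (simp add: P0 matrix_mult_linear_simps)
  then have "transpose (M ** P0) = transpose (P0 ** (M ** P0))" by (rule arg_cong)
  then have "P0 ** M = P0 ** M ** P0"
    by (simp add: transpose_simps tM P0 matrix_mul_assoc)
  with MP show ?thesis by (simp add: matrix_mul_assoc)
qed

text \<open>The off-diagonal block \<open>T = X M S\<close> solves the homogeneous Sylvester equation \<open>X T + T S = 0\<close>,
  and \<open>\<langle>T, X T\<rangle>\<close> and \<open>\<langle>T, T S\<rangle>\<close> are both nonnegative.\<close>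
lemma commute_X:
  assumes M: "M \<in> Sym" and c: "M ** Z = Z ** M"
  shows "M ** X = X ** M"
proof -
  define T where "T = X ** M ** S"
  have tM: "transpose M = M" using M by (simp add: Sym_iff)
  have "X ** T = X ** (X ** M ** S)" by (simp add: T_def)
  also have "\<dots> = (X ** X) ** M ** S" by (simp add: matrix_mul_assoc)
  also have "\<dots> = X ** (Z ** M) ** S" by (simp add: XZ[symmetric] matrix_mul_assoc)
  also have "\<dots> = X ** M ** (Z ** S)" by (simp add: c[symmetric] matrix_mul_assoc)
  also have "\<dots> = - (T ** S)" by (simp add: ZS T_def matrix_mult_linear_simps matrix_mul_assoc)
  finally have e: "X ** T = - (T ** S)" .
  have a: "T \<bullet> (X ** T) = X \<bullet> (T ** transpose T)"
    using inner_mult_right[of X T T] by (simp add: inner_commute)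
  have b: "T \<bullet> (T ** S) = S \<bullet> (transpose T ** T)"
    using inner_mult_left[of T S T] by (simp add: inner_commute)
  have I: "mat 1 \<in> PSD" by (simp add: PSD_def Sym_iff)
  have p1: "T ** transpose T \<in> PSD" and p2: "transpose T ** T \<in> PSD"
    using PSD_congr[OF I, of T] PSD_congr[OF I, of "transpose T"] by simp_all
  have "X \<bullet> (T ** transpose T) = 0"
    using e a b inner_PSD_nonneg[OF X_PSD p1] inner_PSD_nonneg[OF S_PSD p2] by simp
  then have "(T ** transpose T) ** X = 0"
    using complementary_mult_eq_0[OF p1 PSD_Sym[OF X_PSD]] inner_PSD_nonneg[OF X_PSD] by simp
  then have "transpose (transpose T ** X) ** (transpose T ** X) = 0"
    by (simp add: transpose_simps tX matrix_mult_linear_simps flip: matrix_mul_assoc)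
  then have "transpose T ** X = 0" by (simp only: transpose_mult_self_eq_0)
  then have "transpose (transpose T ** X) = 0" by (simp only: transpose_zero)
  then have XT: "X ** T = 0" by (simp add: transpose_simps tX)
  \<comment> \<open>T begins with the factor X, so multiplication by \<open>N ** X\<close> fixes it,
    and \<open>X ** T = 0\<close> forces T to vanish.\<close>
  have "N ** X ** X = X"
  proof -
    have "N ** (X ** X) = N ** Z ** X" by (simp add: ZX[symmetric] matrix_mul_assoc)
    then show ?thesis by (simp add: P0 matrix_ring_simps P0X)
  qed
  then have "N ** X ** T = T" by (simp add: T_def matrix_mul_assoc)
  then have T0: "T = 0" using XT by (simp add: matrix_mult_linear_simps flip: matrix_mul_assoc)
  then have XMS: "X ** M ** S = 0" by (simp add: T_def)
  then have "transpose (X ** M ** S) = 0" by (simp only: transpose_zero)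
  then have SMX: "S ** M ** X = 0" by (simp add: transpose_simps tX tS tM matrix_mul_assoc)
  have XMZ: "X ** M ** Z = X ** M ** X"
    by (simp add: mult_Z XMS)
  have XXM: "X ** X ** M = X ** M ** X"
    using XMZ c by (metis XZ matrix_mul_assoc)
  have "X ** (X ** M - M ** X) = 0"
    by (simp add: matrix_mult_linear_simps matrix_mul_assoc XXM)
  moreover have "S ** (X ** M - M ** X) = 0"
    by (simp add: matrix_mult_linear_simps matrix_mul_assoc SX SMX)
  ultimately have "Z ** (X ** M - M ** X) = 0" by (simp add: mult_Z Z_mult matrix_mult_linear_simps)
  then have "N ** Z ** (X ** M - M ** X) = 0"
    by (simp add: matrix_mult_linear_simps flip: matrix_mul_assoc)
  then have z: "X ** M - M ** X = P0 ** (X ** M - M ** X)"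
    by (simp only: P0 matrix_mult_linear_simps(3) matrix_mul_lid right_minus_eq)
  have "P0 ** (X ** M - M ** X) = - (M ** P0 ** X)"
    by (simp add: matrix_mult_linear_simps matrix_mul_assoc P0X commute_P0[OF assms])
  also have "\<dots> = 0" by (simp add: P0X matrix_mult_linear_simps flip: matrix_mul_assoc)
  finally show ?thesis using z by simp
qed

text \<open>Evaluate \<open>N ** M ** Z ** N = N ** Z ** M ** N\<close> on both sides; the kernel
  terms drop because M commutes with \<open>P0\<close>.\<close>

lemma commute_N:
  assumes M: "M \<in> Sym" and c: "M ** Z = Z ** M"
  shows "M ** N = N ** M"
proof -
  have "N ** M ** (Z ** N) = N ** M - N ** (M ** P0)"
    by (simp add: P0 matrix_ring_simps)
  also have "N ** (M ** P0) = 0"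
    using commute_P0[OF assms] P0 by (metis matrix_mul_assoc matrix_mult_linear_simps(9))
  finally have 1: "N ** M ** (Z ** N) = N ** M" by simp
  have "(N ** Z) ** M ** N = M ** N - (P0 ** M) ** N"
    by (simp add: P0 matrix_ring_simps)
  also have "(P0 ** M) ** N = 0"
    using commute_P0[OF assms] P0 by (metis matrix_mul_assoc matrix_mult_linear_simps(10))
  finally have 2: "(N ** Z) ** M ** N = M ** N" by simp
  show ?thesis using 1 2 c by (metis matrix_mul_assoc)
qed

lemma commute_Ep:
  assumes "M \<in> Sym" "M ** Z = Z ** M"
  shows "M ** Ep = Ep ** M"
  using commute_X[OF assms] commute_N[OF assms] unfolding Ep_def by (metis matrix_mul_assoc)

lemma NX: "N ** X = X ** N"
  using commute_N[OF PSD_Sym[OF X_PSD]] XZ ZX by simp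

lemma Em_eq: "Em = mat 1 - P0 - Ep"
  by (simp add: Em_def Ep_def S_def matrix_ring_simps P0)

lemma commute_Em:
  assumes "M \<in> Sym" "M ** Z = Z ** M"
  shows "M ** Em = Em ** M"
  by (simp add: Em_eq matrix_mult_linear_simps commute_Ep[OF assms] commute_P0[OF assms])

lemma tEp: "transpose Ep = Ep" by (simp add: Ep_def transpose_simps tX P0 NX)
lemma tEm: "transpose Em = Em" by (simp add: Em_eq transpose_simps tEp P0)

lemma EpX: "Ep ** X = X"
proof -
  have "N ** (X ** X) = N ** Z ** X" by (simp add: ZX[symmetric] matrix_mul_assoc)
  then show ?thesis by (simp add: Ep_def P0 matrix_ring_simps P0X)
qed

lemma XEp: "X ** Ep = X"
  using arg_cong[OF EpX, of transpose] by (simp add: transpose_simps tX tEp)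

lemma EpS: "Ep ** S = 0" by (simp add: Ep_def XS matrix_mult_linear_simps flip: matrix_mul_assoc)
lemma EmX: "Em ** X = 0" by (simp add: Em_def SX matrix_mult_linear_simps flip: matrix_mul_assoc)
lemma EpP0: "Ep ** P0 = 0" by (simp add: Ep_def XP0 matrix_mult_linear_simps flip: matrix_mul_assoc)
lemma P0Ep: "P0 ** Ep = 0" by (simp add: Ep_def P0 matrix_mult_linear_simps matrix_mul_assoc)
lemma P0Em: "P0 ** Em = 0" by (simp add: Em_eq P0 P0Ep matrix_mult_linear_simps)
lemma EpEp: "Ep ** Ep = Ep"
  using arg_cong[OF XEp, of "\<lambda>M. N ** M"] by (simp add: Ep_def matrix_mul_assoc)
lemma EpEm: "Ep ** Em = 0" by (simp add: Em_eq EpEp EpP0 matrix_mult_linear_simps)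
lemma EmEm: "Em ** Em = Em"
  by (subst Em_eq) (simp add: EpEm P0Em matrix_mult_linear_simps)
lemma EmS: "Em ** S = S" by (simp add: Em_eq EpS P0S matrix_mult_linear_simps)
lemma SEm: "S ** Em = S"
  using arg_cong[OF EmS, of transpose] by (simp add: transpose_simps tS tEm)

lemma EpZEp: "Ep ** Z ** Ep = X"
  by (simp add: mult_Z Z_mult matrix_mult_linear_simps EpX EpS XEp)

lemma EmZEm: "Em ** Z ** Em = - S"
  by (simp add: mult_Z Z_mult matrix_mult_linear_simps EmX EmS SEm)

text \<open>B vanishes on the complement of the kernel, so there the projection Y agrees with
  \<open>Y - B\<close>; complementarity of Y and \<open>Y - B\<close> then makes Y vanish there as
  well.\<close>

lemma P0_compression_split:
  assumes "B \<in> Sym" "B = P0 ** B ** P0"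
  shows "proj_plus B ** P0 = proj_plus B" "P0 ** proj_plus B = proj_plus B"
proof -
  let ?Y = "proj_plus B"
  let ?R = "mat 1 - P0"
  note m = proj_plus_moreau[OF assms(1)]
  have tY: "transpose ?Y = ?Y" using m(1) by (simp add: PSD_def Sym_iff)
  have BR: "B ** ?R = 0"
    by (subst assms(2)) (simp add: matrix_ring_simps P0)
  then have YR: "?Y ** ?R = (?Y - B) ** ?R" by (simp add: matrix_mult_linear_simps)
  have "transpose (?Y ** ?R) ** (?Y ** ?R) = ?R ** (?Y ** (?Y ** ?R))"
    by (simp add: transpose_simps tY P0 flip: matrix_mul_assoc)
  also have "\<dots> = ?R ** (?Y ** (?Y - B)) ** ?R" by (subst YR) (simp add: matrix_mul_assoc)
  also have "\<dots> = 0" by (simp only: m(3)) (simp add: matrix_mult_linear_simps)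
  finally have "?Y ** ?R = 0" by (simp only: transpose_mult_self_eq_0)
  then show a: "?Y ** P0 = ?Y" by (simp add: matrix_mult_linear_simps)
  show "P0 ** ?Y = ?Y"
    using arg_cong[OF a, of transpose] by (simp add: transpose_simps tY P0)
qed

end

context symmetric_matrix begin
text \<open>Near Z the blocks on the positive and negative eigenspaces keep their definiteness,
  since each perturbation stays in the range of X or S. Only the kernel block can have either sign,
  so it alone is projected. The result supplies the complementary pair for
  \<open>proj_plus_conjugation_approx\<close>.\<close>

lemma block_diagonal_split:
  "\<exists>\<epsilon>>0. \<forall>D\<in>Sym. D ** Z = Z ** D \<longrightarrow> norm (D - Z) \<le> \<epsilon> \<longrightarrow>
    (let Dp = Ep ** D ** Ep + proj_plus (P0 ** D ** P0); Dm = Dp - D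
     in Dp \<in> PSD \<and> Dm \<in> PSD \<and> Dp ** Dm = 0)"
proof -
  obtain \<epsilon>1 where e1: "\<epsilon>1 > 0" "\<And>R. R \<in> Sym \<Longrightarrow> norm R \<le> \<epsilon>1 \<Longrightarrow> X + Ep ** R ** Ep \<in> PSD"
    using PSD_perturbation[OF X_PSD tEp Ep_def] by blast
  have "Em = (- N) ** S" by (simp add: Em_def matrix_mult_linear_simps)
  from PSD_perturbation[OF S_PSD tEm this]
  obtain \<epsilon>2 where e2: "\<epsilon>2 > 0" "\<And>R. R \<in> Sym \<Longrightarrow> norm R \<le> \<epsilon>2 \<Longrightarrow> S + Em ** R ** Em \<in> PSD"
    by blast
  have "Dp \<in> PSD \<and> Dm \<in> PSD \<and> Dp ** Dm = 0"
    if D: "D \<in> Sym" "D ** Z = Z ** D" and n: "norm (D - Z) \<le> min \<epsilon>1 \<epsilon>2"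
      and Dp: "Dp = Ep ** D ** Ep + proj_plus (P0 ** D ** P0)" and Dm: "Dm = Dp - D" for D Dp Dm
  proof -
    let ?B = "P0 ** D ** P0"
    have B: "?B \<in> Sym" "?B = P0 ** ?B ** P0"
      using Sym_congr[OF D(1), of P0] P0 by simp (simp add: matrix_ring_simps P0, simp add: matrix_mul_assoc P0)
    note Y = P0_compression_split[OF B] and m = proj_plus_moreau[OF B(1)]
    let ?Y = "proj_plus ?B"
    let ?p = "Ep ** D ** Ep" and ?m = "Em ** D ** Em"
    have "?p = X + Ep ** (D - Z) ** Ep"
      by (simp add: matrix_mult_linear_simps EpZEp)
    then have p: "?p \<in> PSD" using e1(2)[of "D - Z"] n D Z_Sym by (simp add: Sym_diff)
    have "- ?m = S + Em ** (- (D - Z)) ** Em"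
      by (simp add: matrix_mult_linear_simps EmZEm)
    then have mm: "- ?m \<in> PSD"
      using e2(2)[of "- (D - Z)"] n D Z_Sym by (simp add: Sym_diff norm_minus_commute)
    \<comment> \<open>The projectors \<open>Ep\<close>, \<open>P0\<close>, \<open>Em\<close> add up
      to the identity and commute with D, so there are no off-diagonal blocks.\<close>
    have D_eq: "D = ?p + ?B + ?m"
    proof -
      have "?p + ?B + ?m = D ** (Ep ** Ep) + D ** (P0 ** P0) + D ** (Em ** Em)"
        by (simp add: matrix_mul_assoc commute_Ep[OF D] commute_Em[OF D] commute_P0[OF D])
      also have "\<dots> = D" by (simp add: EpEp EmEm P0) (simp add: Em_eq matrix_mult_linear_simps)
      finally show ?thesis by simp
    qed
    have Dm_eq: "Dm = (?Y - ?B) + (- ?m)"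
      unfolding Dm Dp by (subst (2) D_eq) simp
    have z1: "Ep ** A = 0 \<Longrightarrow> Ep ** D ** Ep ** A = 0" for A
      by (simp add: matrix_mult_linear_simps flip: matrix_mul_assoc)
    have z2: "Ep ** (?Y - ?B) = 0"
    proof -
      have "Ep ** ?Y = 0" using Y(2) EpP0 by (metis matrix_mul_assoc matrix_mult_linear_simps(9))
      moreover have "Ep ** ?B = 0" by (simp add: matrix_mul_assoc EpP0 matrix_mult_linear_simps)
      ultimately show ?thesis by (simp add: matrix_mult_linear_simps)
    qed
    have z3: "Ep ** (- ?m) = 0" by (simp add: matrix_mul_assoc EpEm matrix_mult_linear_simps)
    have z4: "?Y ** (- ?m) = 0"
    proof -
      have "?Y ** Em = 0" using Y(1) P0Em by (metis matrix_mul_assoc matrix_mult_linear_simps(10))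
      then show ?thesis by (simp add: matrix_mul_assoc matrix_mult_linear_simps)
    qed
    have "Dp ** Dm = ?p ** (?Y - ?B) + ?p ** (- ?m) + ?Y ** (?Y - ?B) + ?Y ** (- ?m)"
      unfolding Dm_eq Dp by (simp only: matrix_mult_linear_simps add.assoc) (simp add: algebra_simps)
    also have "\<dots> = 0" using z1[OF z2] z1[OF z3] z4 m by simp
    finally have "Dp ** Dm = 0" .
    moreover have "Dp \<in> PSD" unfolding Dp by (intro PSD_add p m)
    moreover have "Dm \<in> PSD" unfolding Dm_eq by (intro PSD_add mm m)
    ultimately show ?thesis by blast
  qed
  then show ?thesis using e1(1) e2(1) by (intro exI[of _ "min \<epsilon>1 \<epsilon>2"]) (auto simp: Let_def)
qed

end

section \<open>Directional derivatives of the projection\<close>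

definition expands1 :: "(real \<Rightarrow> 'a::real_normed_vector) \<Rightarrow> 'a \<Rightarrow> 'a \<Rightarrow> bool" where
  "expands1 f a b \<longleftrightarrow> ((\<lambda>t. (f t - a) /\<^sub>R t) \<longlongrightarrow> b) (at_right 0)"

text \<open>Here c is the plain coefficient of the square of t, without the factor 1/2. Iterating
  the difference quotient lets every second-order rule follow from two uses of the first-order
  one.\<close>

definition expands2 :: "(real \<Rightarrow> 'a::real_normed_vector) \<Rightarrow> 'a \<Rightarrow> 'a \<Rightarrow> 'a \<Rightarrow> bool" where
  "expands2 f a b c \<longleftrightarrow> expands1 (\<lambda>t. (f t - a) /\<^sub>R t) b c"

lemma eventually_at_right_0: "(\<And>t. t > 0 \<Longrightarrow> P t) \<Longrightarrow> eventually P (at_right (0::real))"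
  using eventually_at_right_less[of "0::real"] by (auto elim: eventually_mono)

lemma expands1_cong:
  "(\<And>t. t > 0 \<Longrightarrow> f t = g t) \<Longrightarrow> expands1 f a b \<longleftrightarrow> expands1 g a b"
  unfolding expands1_def by (intro tendsto_cong eventually_at_right_0) simp

lemma expands1_tendsto:
  assumes "expands1 f a b"
  shows "(f \<longlongrightarrow> a) (at_right 0)"
proof -
  have "((\<lambda>t::real. a + t *\<^sub>R ((f t - a) /\<^sub>R t)) \<longlongrightarrow> a + 0 *\<^sub>R b) (at_right 0)"
    using assms unfolding expands1_def by (intro tendsto_intros)
  moreover have "eventually (\<lambda>t. a + t *\<^sub>R ((f t - a) /\<^sub>R t) = f t) (at_right 0)"
    by (rule eventually_at_right_0) simp
  ultimately show ?thesis by (simp add: tendsto_cong)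
qed

lemma expands2_imp_expands1: "expands2 f a b c \<Longrightarrow> expands1 f a b"
  unfolding expands2_def by (drule expands1_tendsto) (simp add: expands1_def)

lemma expands1_add:
  "expands1 f a b \<Longrightarrow> expands1 g a' b' \<Longrightarrow> expands1 (\<lambda>t. f t + g t) (a + a') (b + b')"
  unfolding expands1_def by (drule (1) tendsto_add) (simp add: algebra_simps)

lemma expands2_add:
  "expands2 f a b c \<Longrightarrow> expands2 g a' b' c' \<Longrightarrow> expands2 (\<lambda>t. f t + g t) (a + a') (b + b') (c + c')"
  unfolding expands2_def by (drule (1) expands1_add) (simp add: algebra_simps)

lemma expands1_diff:
  "expands1 f a b \<Longrightarrow> expands1 g a' b' \<Longrightarrow> expands1 (\<lambda>t. f t - g t) (a - a') (b - b')"
  unfolding expands1_def by (drule (1) tendsto_diff) (simp add: algebra_simps)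

lemma expands2_diff:
  "expands2 f a b c \<Longrightarrow> expands2 g a' b' c' \<Longrightarrow> expands2 (\<lambda>t. f t - g t) (a - a') (b - b') (c - c')"
  unfolding expands2_def by (drule (1) expands1_diff) (simp add: algebra_simps)

lemma expands1_mult:
  fixes f :: "real \<Rightarrow> real^'n^'m" and g :: "real \<Rightarrow> real^'p^'n"
  assumes "expands1 f a b" "expands1 g a' b'"
  shows "expands1 (\<lambda>t. f t ** g t) (a ** a') (b ** a' + a ** b')"
proof -
  have "((\<lambda>t. ((f t - a) /\<^sub>R t) ** g t + a ** ((g t - a') /\<^sub>R t)) \<longlongrightarrow> b ** a' + a ** b') (at_right 0)"
    using assms(1) assms(2)[unfolded expands1_def] expands1_tendsto[OF assms(2)]
    unfolding expands1_def
    by (intro tendsto_add bounded_bilinear.tendsto[OF bounded_bilinear_matrix_mult] tendsto_const)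
  moreover have "((f t - a) /\<^sub>R t) ** g t + a ** ((g t - a') /\<^sub>R t) = (f t ** g t - a ** a') /\<^sub>R t" for t
    by (simp add: matrix_mult_linear_simps algebra_simps)
  ultimately show ?thesis unfolding expands1_def by simp
qed

text \<open>By the Leibniz formula the difference quotient of the product is a sum of products, and
  the first-order product rule applies to each.\<close>

lemma expands2_mult:
  fixes f :: "real \<Rightarrow> real^'n^'m" and g :: "real \<Rightarrow> real^'p^'n"
  assumes "expands2 f a b c" "expands2 g a' b' c'"
  shows "expands2 (\<lambda>t. f t ** g t) (a ** a') (b ** a' + a ** b') (c ** a' + b ** b' + a ** c')"
proof -
  have const: "expands1 (\<lambda>t. a) a 0" by (simp add: expands1_def)
  have "expands1 (\<lambda>t. ((f t - a) /\<^sub>R t) ** g t + a ** ((g t - a') /\<^sub>R t))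
      (b ** a' + a ** b') ((c ** a' + b ** b') + (0 ** b' + a ** c'))"
    using assms expands2_imp_expands1[OF assms(2)] const unfolding expands2_def
    by (intro expands1_add expands1_mult)
  moreover have "((f t - a) /\<^sub>R t) ** g t + a ** ((g t - a') /\<^sub>R t) = (f t ** g t - a ** a') /\<^sub>R t" for t
    by (simp add: matrix_mult_linear_simps algebra_simps)
  ultimately show ?thesis by (simp add: expands2_def matrix_mult_linear_simps add.assoc)
qed

lemma expands1_linear_poly: "expands1 (\<lambda>t. a + t *\<^sub>R b) a b"
proof -
  have "eventually (\<lambda>t. b = (a + t *\<^sub>R b - a) /\<^sub>R t) (at_right 0)" by (rule eventually_at_right_0) simp
  then show ?thesis unfolding expands1_def by (simp add: tendsto_eventually eventually_mono)
qed

lemma expands2_quadratic_poly: "expands2 (\<lambda>t. a + t *\<^sub>R b + t\<^sup>2 *\<^sub>R c) a b c"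
proof -
  have "(a + t *\<^sub>R b + t\<^sup>2 *\<^sub>R c - a) /\<^sub>R t = b + t *\<^sub>R c" if "t > 0" for t
    using that by (simp add: algebra_simps power2_eq_square)
  then have "expands1 (\<lambda>t. (a + t *\<^sub>R b + t\<^sup>2 *\<^sub>R c - a) /\<^sub>R t) b c \<longleftrightarrow> expands1 (\<lambda>t. b + t *\<^sub>R c) b c"
    by (rule expands1_cong)
  then show ?thesis using expands1_linear_poly by (simp add: expands2_def)
qed

lemma expands1_same_coeffs:
  assumes "expands1 f a b" "expands1 g a b"
  shows "((\<lambda>t. (f t - g t) /\<^sub>R t) \<longlongrightarrow> 0) (at_right 0)"
  using expands1_diff[OF assms] by (simp add: expands1_def)

lemma expands2_same_coeffs:
  assumes "expands2 f a b c" "expands2 g a b c"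
  shows "((\<lambda>t. (f t - g t) /\<^sub>R t\<^sup>2) \<longlongrightarrow> 0) (at_right 0)"
proof -
  have "((\<lambda>t. (f t - g t) /\<^sub>R t /\<^sub>R t) \<longlongrightarrow> 0) (at_right 0)"
    using expands2_diff[OF assms] by (simp add: expands2_def expands1_def)
  then show ?thesis by (simp add: power2_eq_square)
qed

lemma expands1_perturb:
  assumes "expands1 g a b" "((\<lambda>t. (f t - g t) /\<^sub>R t) \<longlongrightarrow> 0) (at_right 0)"
  shows "expands1 f a b"
proof -
  have "expands1 (\<lambda>t. f t - g t) 0 0" using assms(2) by (simp add: expands1_def)
  from expands1_add[OF this assms(1)] show ?thesis by simp
qed

lemma expands2_perturb:
  assumes "expands2 g a b c" "((\<lambda>t. (f t - g t) /\<^sub>R t\<^sup>2) \<longlongrightarrow> 0) (at_right 0)"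
  shows "expands2 f a b c"
proof -
  have "expands2 (\<lambda>t. f t - g t) 0 0 0"
    using assms(2) by (simp add: expands1_def expands2_def power2_eq_square)
  from expands2_add[OF this assms(1)] show ?thesis by simp
qed

text \<open>Approximate orthogonality of \<open>U\<close> suffices: since \<open>D\<^sub>+ D\<^sub>- = 0\<close>, the complementarity defect
  \<open>\<langle>U D\<^sub>+ U\<^sup>T, U D\<^sub>- U\<^sup>T\<rangle>\<close> is quadratic in \<open>U\<^sup>T U - 1\<close>.\<close>
lemma proj_plus_conjugation_approx:
  fixes U Dp Dm M :: "real \<Rightarrow> 'n::finite mat" and r :: "real \<Rightarrow> real"
  assumes Fp: "eventually (\<lambda>t. r t > 0) F"
    and D: "eventually (\<lambda>t. Dp t \<in> PSD \<and> Dm t \<in> PSD \<and> Dp t ** Dm t = 0) F"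
    and lim: "(Dp \<longlongrightarrow> dp) F" "(Dm \<longlongrightarrow> dm) F"
    and U: "((\<lambda>t. (transpose (U t) ** U t - mat 1) /\<^sub>R r t) \<longlongrightarrow> 0) F"
    and M: "((\<lambda>t. (M t - U t ** (Dp t - Dm t) ** transpose (U t)) /\<^sub>R r t) \<longlongrightarrow> 0) F"
  shows "((\<lambda>t. (proj_plus (M t) - U t ** Dp t ** transpose (U t)) /\<^sub>R r t) \<longlongrightarrow> 0) F"
proof -
  define G where "G t = (transpose (U t) ** U t - mat 1) /\<^sub>R r t" for t
  \<comment> \<open>There are two sources of error, both divided by \<open>r t\<close>: the
    Lipschitz bound for replacing \<open>M t\<close> by the conjugated matrix, and the root of the
    complementarity defect from \<open>norm_proj_plus_diff_le\<close>.\<close>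
  define E where "E t = norm ((M t - U t ** (Dp t - Dm t) ** transpose (U t)) /\<^sub>R r t)
      + sqrt (Dp t \<bullet> (G t ** Dm t ** G t))" for t
  have G: "(G \<longlongrightarrow> 0) F" using U by (simp add: G_def[abs_def])
  have "(E \<longlongrightarrow> norm (0::'n mat) + sqrt (dp \<bullet> (0 ** dm ** 0))) F"
    unfolding E_def
    by (intro tendsto_intros M lim G bounded_bilinear.tendsto[OF bounded_bilinear_matrix_mult])
  then have E0: "(E \<longlongrightarrow> 0) F" by (simp add: matrix_mult_linear_simps)
  have "eventually (\<lambda>t. norm ((proj_plus (M t) - U t ** Dp t ** transpose (U t)) /\<^sub>R r t) \<le> E t) F"
    using Fp D
  proof eventually_elim
    case (elim t)
    then have p: "Dp t \<in> PSD" and m: "Dm t \<in> PSD" and z: "Dp t ** Dm t = 0" and r: "r t > 0" by auto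
    let ?V = "transpose (U t)"
    let ?Y = "U t ** Dp t ** ?V" and ?S = "U t ** Dm t ** ?V"
    have tp: "transpose (Dp t) = Dp t" and tm: "transpose (Dm t) = Dm t"
      using p m by (auto simp: PSD_def Sym_iff)
    have VU: "?V ** U t = mat 1 + r t *\<^sub>R G t" using r by (simp add: G_def)
    have mz: "Dm t ** Dp t = 0"
      using arg_cong[OF z, of transpose] by (simp add: transpose_simps tp tm)
    have "?Y \<bullet> ?S = Dp t \<bullet> ((?V ** U t) ** Dm t ** (?V ** U t))"
      by (simp add: inner_mult_right[of _ ?V] inner_mult_left[of "U t"] matrix_mul_assoc)
    also have "\<dots> = Dp t \<bullet> Dm t + r t * (Dp t \<bullet> (G t ** Dm t)) + r t * (Dp t \<bullet> (Dm t ** G t))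
        + (r t)\<^sup>2 * (Dp t \<bullet> (G t ** Dm t ** G t))"
      by (simp add: VU matrix_ring_simps inner_add_right power2_eq_square algebra_simps)
    also have "Dp t \<bullet> Dm t = 0" by (simp add: inner_eq_trace tp z trace_def)
    also have "Dp t \<bullet> (Dm t ** G t) = 0"
      by (simp add: inner_commute[of "Dp t"] inner_mult_left tm mz)
    also have "Dp t \<bullet> (G t ** Dm t) = 0"
      by (simp add: inner_commute[of "Dp t"] inner_mult_right tm z)
    finally have YS: "?Y \<bullet> ?S = (r t)\<^sup>2 * (Dp t \<bullet> (G t ** Dm t ** G t))" by simp
    have "?Y \<in> PSD" "?S \<in> PSD" by (intro PSD_congr p m)+
    then have "(norm (proj_plus (?Y - ?S) - ?Y))\<^sup>2 \<le> (r t)\<^sup>2 * (Dp t \<bullet> (G t ** Dm t ** G t))"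
      using norm_proj_plus_diff_le YS by metis
    then have "norm (proj_plus (?Y - ?S) - ?Y) \<le> sqrt ((r t)\<^sup>2 * (Dp t \<bullet> (G t ** Dm t ** G t)))"
      by (rule real_le_rsqrt)
    also have "\<dots> = r t * sqrt (Dp t \<bullet> (G t ** Dm t ** G t))" using r by (simp add: real_sqrt_mult)
    finally have 1: "norm (proj_plus (?Y - ?S) - ?Y) \<le> \<dots>" .
    have "norm (proj_plus (M t) - ?Y) \<le> norm (proj_plus (M t) - proj_plus (?Y - ?S)) + norm (proj_plus (?Y - ?S) - ?Y)"
      by (rule norm_diff_triangle_le[OF order_refl order_refl])
    also have "\<dots> \<le> norm (M t - (?Y - ?S)) + r t * sqrt (Dp t \<bullet> (G t ** Dm t ** G t))"
      by (intro add_mono proj_plus_lipschitz 1)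
    finally have "norm (proj_plus (M t) - ?Y) \<le> r t * E t"
      using r by (simp add: E_def matrix_mult_linear_simps distrib_left mult.assoc[symmetric])
    then have "inverse (r t) * norm (proj_plus (M t) - ?Y) \<le> inverse (r t) * (r t * E t)"
      using r by (intro mult_left_mono) auto
    then show ?case using r by (simp add: mult.assoc[symmetric])
  qed
  then show ?thesis by (rule Lim_null_comparison) (rule E0)
qed

section \<open>Existence of the directional derivatives of the PSD projection\<close>

context symmetric_matrix begin

lemma commutator_decomposition:
  obtains k where "linear k"
    "\<And>W. W \<in> Sym \<Longrightarrow> transpose (k W) = - k W"
    "\<And>W. W \<in> Sym \<Longrightarrow> P0 ** k W ** P0 = 0"
    "\<And>W. W \<in> Sym \<Longrightarrow> (W - (k W ** Z - Z ** k W)) \<in> Sym"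
    "\<And>W. W \<in> Sym \<Longrightarrow> (W - (k W ** Z - Z ** k W)) ** Z = Z ** (W - (k W ** Z - Z ** k W))"
proof -
  obtain k where k: "linear k" "\<forall>W\<in>Sym. transpose (k W) = - k W \<and> P0 ** k W ** P0 = 0 \<and>
      (W - (k W ** Z - Z ** k W)) ** Z = Z ** (W - (k W ** Z - Z ** k W))"
    using Sym_commutator_decomposition[OF Z_Sym P0(2,1,3,4)] by blast
  moreover have "(W - (k W ** Z - Z ** k W)) \<in> Sym" if "W \<in> Sym" for W
    using that k(2) by (simp add: Sym_iff transpose_simps tZ matrix_mult_linear_simps)
  ultimately show ?thesis using that by blast
qed

text \<open>The part of H outside the commutant of Z is generated by the rotation K, so conjugating
  \<open>Z + t *\<^sub>R H1\<close> by U reproduces the perturbed matrix up to o(t), and its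
  projection is obtained blockwise.\<close>

lemma proj_plus_expands1:
  assumes H: "H \<in> Sym"
  shows "\<exists>B. expands1 (\<lambda>t. proj_plus (Z + t *\<^sub>R H)) X B"
proof -
  obtain k where k: "linear k" "transpose (k H) = - k H"
    "(H - (k H ** Z - Z ** k H)) \<in> Sym"
    "(H - (k H ** Z - Z ** k H)) ** Z = Z ** (H - (k H ** Z - Z ** k H))"
    using commutator_decomposition H by metis
  define K where "K = k H"
  define H1 where "H1 = H - (K ** Z - Z ** K)"
  have tK: "transpose K = - K" and H1: "H1 \<in> Sym" "H1 ** Z = Z ** H1"
    using k by (simp_all add: K_def H1_def)
  define U where "U t = mat 1 + t *\<^sub>R K" for t
  define V where "V t = mat 1 + t *\<^sub>R (- K)" for t
  define D where "D t = Z + t *\<^sub>R H1" for t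
  define Dp where "Dp t = Ep ** D t ** Ep + proj_plus (P0 ** D t ** P0)" for t
  define Dm where "Dm t = Dp t - D t" for t
  have tU: "transpose (U t) = V t" for t by (simp add: U_def V_def transpose_simps tK)
  have D_Sym: "D t \<in> Sym" and D_comm: "D t ** Z = Z ** D t" for t
    using H1 Z_Sym by (auto simp: D_def matrix_mult_linear_simps intro: Sym_add Sym_scaleR)
  have eU: "expands1 U (mat 1) K" and eV: "expands1 V (mat 1) (- K)" and eD: "expands1 D Z H1"
    unfolding U_def V_def D_def by (rule expands1_linear_poly)+
  define Q where "Q = Ep ** H1 ** Ep + proj_plus (P0 ** H1 ** P0)"
  \<comment> \<open>The kernel block of \<open>D t\<close> is exactly t times a fixed matrix, so
    positive homogeneity makes \<open>Dp\<close> affine for t > 0, although the projection is not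
    smooth at 0.\<close>
  have Dp_eq: "Dp t = X + t *\<^sub>R Q" if "t > 0" for t
  proof -
    have "P0 ** D t ** P0 = t *\<^sub>R (P0 ** H1 ** P0)"
      by (simp add: D_def matrix_mult_linear_simps P0)
    then show ?thesis using that
      by (simp add: Dp_def Q_def proj_plus_scaleR) (simp add: D_def matrix_mult_linear_simps EpZEp algebra_simps)
  qed
  have eDp: "expands1 Dp X Q"
    using expands1_cong[of Dp "\<lambda>t. X + t *\<^sub>R Q", OF Dp_eq] expands1_linear_poly[of X Q] by simp
  obtain \<epsilon> where eps: "\<epsilon> > 0" "\<And>D. D \<in> Sym \<Longrightarrow> D ** Z = Z ** D \<Longrightarrow> norm (D - Z) \<le> \<epsilon> \<Longrightarrow>
    (let Dp = Ep ** D ** Ep + proj_plus (P0 ** D ** P0); Dm = Dp - D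
     in Dp \<in> PSD \<and> Dm \<in> PSD \<and> Dp ** Dm = 0)"
    using block_diagonal_split by blast
  have "eventually (\<lambda>t. dist (D t) Z < \<epsilon>) (at_right 0)"
    using expands1_tendsto[OF eD] eps(1) by (rule tendstoD)
  then have ev: "eventually (\<lambda>t. Dp t \<in> PSD \<and> Dm t \<in> PSD \<and> Dp t ** Dm t = 0) (at_right 0)"
  proof eventually_elim
    case (elim t)
    then show ?case
      using eps(2)[OF D_Sym D_comm, of t] by (simp add: Let_def Dp_def Dm_def dist_norm)
  qed
  have "((\<lambda>t. (proj_plus (Z + t *\<^sub>R H) - U t ** Dp t ** transpose (U t)) /\<^sub>R t) \<longlongrightarrow> 0) (at_right 0)"
  proof (rule proj_plus_conjugation_approx[OF _ ev])
    show "eventually (\<lambda>t. t > 0) (at_right (0::real))" by (rule eventually_at_right_0)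
    show "(Dp \<longlongrightarrow> X) (at_right 0)" by (rule expands1_tendsto[OF eDp])
    then show "(Dm \<longlongrightarrow> X - Z) (at_right 0)"
      unfolding Dm_def by (intro tendsto_diff expands1_tendsto[OF eD])
    have "expands1 (\<lambda>t. V t ** U t) (mat 1) 0"
      using expands1_mult[OF eV eU] by simp
    then show "((\<lambda>t. (transpose (U t) ** U t - mat 1) /\<^sub>R t) \<longlongrightarrow> 0) (at_right 0)"
      by (simp add: expands1_def tU)
    have "expands1 (\<lambda>t. U t ** D t ** V t) Z H"
      using expands1_mult[OF expands1_mult[OF eU eD] eV] by (simp add: H1_def matrix_ring_simps)
    from expands1_same_coeffs[OF expands1_linear_poly this]
    show "((\<lambda>t. (Z + t *\<^sub>R H - U t ** (Dp t - Dm t) ** transpose (U t)) /\<^sub>R t) \<longlongrightarrow> 0) (at_right 0)"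
      by (simp add: tU Dm_def)
  qed
  then have "((\<lambda>t. (proj_plus (Z + t *\<^sub>R H) - U t ** Dp t ** V t) /\<^sub>R t) \<longlongrightarrow> 0) (at_right 0)"
    by (simp add: tU)
  moreover have "expands1 (\<lambda>t. U t ** Dp t ** V t) X (K ** X + Q - X ** K)"
    using expands1_mult[OF expands1_mult[OF eU eDp] eV] by (simp add: matrix_ring_simps)
  ultimately have "expands1 (\<lambda>t. proj_plus (Z + t *\<^sub>R H)) X (K ** X + Q - X ** K)"
    by (rule expands1_perturb[rotated])
  then show ?thesis ..
qed

end

text \<open>\<open>dir1\<close> is a \<open>Lim\<close>, which carries no information until
  convergence is established.\<close>

lemma dir1_proj_plus_tendsto:
  assumes "Z \<in> Sym" "H \<in> Sym"
  shows "((\<lambda>t. (proj_plus (Z + t *\<^sub>R H) - proj_plus Z) /\<^sub>R t) \<longlongrightarrow> dir1 proj_plus Z H) (at_right 0)"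
proof -
  interpret symmetric_matrix Z by standard (rule assms)
  obtain B where B: "((\<lambda>t. (proj_plus (Z + t *\<^sub>R H) - proj_plus Z) /\<^sub>R t) \<longlongrightarrow> B) (at_right 0)"
    using proj_plus_expands1[OF assms(2)] unfolding expands1_def X_def by blast
  then have "dir1 proj_plus Z H = B" unfolding dir1_def by (intro tendsto_Lim) auto
  with B show ?thesis by simp
qed

lemma dir1_proj_plus_scaleR:
  assumes "Z \<in> Sym" "H \<in> Sym" "c \<ge> 0"
  shows "dir1 proj_plus Z (c *\<^sub>R H) = c *\<^sub>R dir1 proj_plus Z H"
proof (cases "c = 0")
  case True
  have "dir1 proj_plus Z 0 = 0" unfolding dir1_def by (intro tendsto_Lim) auto
  then show ?thesis using True by simp
next
  case False
  with assms have c: "c > 0" by simp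
  have "filterlim (\<lambda>t. c * t) (at_right 0) (at_right 0)"
    using filtermap_times_pos_at_right[OF c, of 0] by (simp add: filterlim_def)
  from filterlim_compose[OF dir1_proj_plus_tendsto[OF assms(1,2)] this]
  have "((\<lambda>t. c *\<^sub>R ((proj_plus (Z + (c * t) *\<^sub>R H) - proj_plus Z) /\<^sub>R (c * t))) \<longlongrightarrow> c *\<^sub>R dir1 proj_plus Z H) (at_right 0)"
    by (intro tendsto_intros)
  moreover have "c *\<^sub>R ((proj_plus (Z + (c * t) *\<^sub>R H) - proj_plus Z) /\<^sub>R (c * t))
      = (proj_plus (Z + t *\<^sub>R (c *\<^sub>R H)) - proj_plus Z) /\<^sub>R t" for t
    using c by (simp add: mult.commute)
  ultimately show ?thesis unfolding dir1_def[of _ _ "c *\<^sub>R H"] by (intro tendsto_Lim) auto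
qed

context symmetric_matrix begin

text \<open>The quantifiers matter: l, \<open>f1\<close> and c serve all W at once, so the nonlinear
  dependence on W is isolated in the kernel block.\<close>

lemma proj_plus_expands2:
  assumes H: "H \<in> Sym"
  shows "\<exists>l f1 c. linear l \<and> (\<forall>W\<in>Sym. expands2 (\<lambda>t. proj_plus (Z + t *\<^sub>R H + (t\<^sup>2/2) *\<^sub>R W)) X f1
       (c + l W + dir1 proj_plus (P0 ** H ** P0) ((1/2) *\<^sub>R (P0 ** (W - Upsilon Z H) ** P0))))"
proof -
  obtain k where k: "linear k"
    "\<And>W. W \<in> Sym \<Longrightarrow> transpose (k W) = - k W"
    "\<And>W. W \<in> Sym \<Longrightarrow> P0 ** k W ** P0 = 0"
    "\<And>W. W \<in> Sym \<Longrightarrow> (W - (k W ** Z - Z ** k W)) \<in> Sym"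
    "\<And>W. W \<in> Sym \<Longrightarrow> (W - (k W ** Z - Z ** k W)) ** Z = Z ** (W - (k W ** Z - Z ** k W))"
    using commutator_decomposition by metis
  have tH: "transpose H = H" using H by (simp add: Sym_iff)
  define K where "K = k H"
  define H1 where "H1 = H - (K ** Z - Z ** K)"
  have tK: "transpose K = - K" and H1: "H1 \<in> Sym" "H1 ** Z = Z ** H1" and PKP: "P0 ** K ** P0 = 0"
    using k H by (simp_all add: K_def H1_def)
  \<comment> \<open>The second-order coefficient of the conjugated curve that K and
    \<open>H1\<close> already produce; what remains of \<open>(1/2) *\<^sub>R W\<close> is
    decomposed afresh by k.\<close>
  define c0 where "c0 = K ** H1 - H1 ** K + (1/2) *\<^sub>R (K ** K ** Z + Z ** K ** K) - K ** Z ** K"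
  have c0: "c0 \<in> Sym"
    using H1(1) by (simp add: c0_def Sym_iff transpose_simps tK tZ matrix_ring_simps)
  define H00 where "H00 = P0 ** H ** P0"
  have H00_Sym: "H00 \<in> Sym" using Sym_congr[OF H, of P0] P0 by (simp add: H00_def)
  have PH1P: "P0 ** H1 ** P0 = H00"
    by (simp add: H1_def H00_def matrix_ring_simps P0) (simp add: matrix_mul_assoc P0 matrix_mult_linear_simps)
  define Q1 where "Q1 = Ep ** H1 ** Ep + proj_plus H00"
  define g where "g W = W - (k W ** Z - Z ** k W)" for W
  have lg: "linear g"
    using k(1) by (auto simp: linear_iff g_def matrix_mult_linear_simps algebra_simps)
  define l where "l W = (1/2) *\<^sub>R (Ep ** g W ** Ep + k W ** X - X ** k W)" for W
  \<comment> \<open>Everything independent of W. The last term appears because k and g are applied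
    to \<open>(1/2) *\<^sub>R W - c0\<close>, while l already contains the factor 1/2.\<close>
  define c where "c = K ** Q1 - Q1 ** K + (1/2) *\<^sub>R (K ** K ** X + X ** K ** K) - K ** X ** K - 2 *\<^sub>R l c0"
  have ll: "linear l"
    using k(1) lg by (auto simp: linear_iff l_def matrix_mult_linear_simps algebra_simps)
  obtain \<epsilon> where eps: "\<epsilon> > 0" "\<And>D. D \<in> Sym \<Longrightarrow> D ** Z = Z ** D \<Longrightarrow> norm (D - Z) \<le> \<epsilon> \<Longrightarrow>
    (let Dp = Ep ** D ** Ep + proj_plus (P0 ** D ** P0); Dm = Dp - D
     in Dp \<in> PSD \<and> Dm \<in> PSD \<and> Dp ** Dm = 0)"
    using block_diagonal_split by blast
  have "expands2 (\<lambda>t. proj_plus (Z + t *\<^sub>R H + (t\<^sup>2/2) *\<^sub>R W)) X (K ** X - X ** K + Q1)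
       (c + l W + dir1 proj_plus (P0 ** H ** P0) ((1/2) *\<^sub>R (P0 ** (W - Upsilon Z H) ** P0)))"
    if W: "W \<in> Sym" for W
  proof -
    define Q where "Q = (1/2) *\<^sub>R W - c0"
    have Q: "Q \<in> Sym" using W c0 by (auto simp: Q_def intro: Sym_diff Sym_scaleR)
    define K2 where "K2 = k Q"
    define G1 where "G1 = g Q"
    have G1: "G1 \<in> Sym" "G1 ** Z = Z ** G1" and tK2: "transpose K2 = - K2"
      using k Q by (simp_all add: G1_def K2_def g_def)
    \<comment> \<open>The second-order coefficient of the exponential of
      \<open>t *\<^sub>R K + t\<^sup>2 *\<^sub>R K2\<close>. As K and \<open>K2\<close> are skew,
      \<open>L'\<close> is its transpose and the coefficients of t and its square in
      \<open>V t ** U t\<close> cancel.\<close>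
    define L where "L = (1/2) *\<^sub>R (K ** K) + K2"
    define L' where "L' = (1/2) *\<^sub>R (K ** K) - K2"
    define U where "U t = mat 1 + t *\<^sub>R K + t\<^sup>2 *\<^sub>R L" for t
    define V where "V t = mat 1 + t *\<^sub>R (- K) + t\<^sup>2 *\<^sub>R L'" for t
    define D where "D t = Z + t *\<^sub>R H1 + t\<^sup>2 *\<^sub>R G1" for t
    define Dp where "Dp t = Ep ** D t ** Ep + proj_plus (P0 ** D t ** P0)" for t
    define Dm where "Dm t = Dp t - D t" for t
    define V00 where "V00 = P0 ** G1 ** P0"
    define q where "q = dir1 proj_plus H00 V00"
    have V00_Sym: "V00 \<in> Sym" using Sym_congr[OF G1(1), of P0] P0 by (simp add: V00_def)
    have tU: "transpose (U t) = V t" for t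
      by (simp add: U_def V_def L_def L'_def transpose_simps tK tK2 matrix_ring_simps)
    have D_Sym: "D t \<in> Sym" and D_comm: "D t ** Z = Z ** D t" for t
      using H1 G1 Z_Sym by (auto simp: D_def matrix_mult_linear_simps intro: Sym_add Sym_scaleR)
    have eU: "expands2 U (mat 1) K L" and eV: "expands2 V (mat 1) (- K) L'" and eD: "expands2 D Z H1 G1"
      unfolding U_def V_def D_def by (rule expands2_quadratic_poly)+
    \<comment> \<open>The kernel block of \<open>D t\<close> is t times
      \<open>H00 + t *\<^sub>R V00\<close>; with one t taken out, a first-order expansion at
      \<open>H00\<close> is enough.\<close>
    have e00: "expands2 (\<lambda>t. proj_plus (P0 ** D t ** P0)) 0 (proj_plus H00) q"
    proof -
      have "(proj_plus (P0 ** D t ** P0) - 0) /\<^sub>R t = proj_plus (H00 + t *\<^sub>R V00)" if "t > 0" for t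
      proof -
        have "P0 ** D t ** P0 = t *\<^sub>R (H00 + t *\<^sub>R V00)"
          by (simp add: D_def V00_def PH1P[symmetric] matrix_mult_linear_simps P0 algebra_simps power2_eq_square)
        then show ?thesis using that by (simp add: proj_plus_scaleR)
      qed
      then have "expands1 (\<lambda>t. (proj_plus (P0 ** D t ** P0) - 0) /\<^sub>R t) (proj_plus H00) q
         \<longleftrightarrow> expands1 (\<lambda>t. proj_plus (H00 + t *\<^sub>R V00)) (proj_plus H00) q"
        by (rule expands1_cong)
      then show ?thesis
        using dir1_proj_plus_tendsto[OF H00_Sym V00_Sym] by (simp add: expands2_def expands1_def q_def)
    qed
    have "expands2 (\<lambda>t. X + t *\<^sub>R (Ep ** H1 ** Ep) + t\<^sup>2 *\<^sub>R (Ep ** G1 ** Ep)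
        + proj_plus (P0 ** D t ** P0)) (X + 0) (Ep ** H1 ** Ep + proj_plus H00) (Ep ** G1 ** Ep + q)"
      by (intro expands2_add expands2_quadratic_poly e00)
    moreover have "Dp = (\<lambda>t. X + t *\<^sub>R (Ep ** H1 ** Ep) + t\<^sup>2 *\<^sub>R (Ep ** G1 ** Ep)
        + proj_plus (P0 ** D t ** P0))"
      by (simp add: fun_eq_iff Dp_def) (simp add: D_def matrix_mult_linear_simps EpZEp)
    ultimately have eDp: "expands2 Dp X Q1 (Ep ** G1 ** Ep + q)"
      by (simp add: Q1_def)
    have "eventually (\<lambda>t. dist (D t) Z < \<epsilon>) (at_right 0)"
      using expands1_tendsto[OF expands2_imp_expands1[OF eD]] eps(1) by (rule tendstoD)
    then have ev: "eventually (\<lambda>t. Dp t \<in> PSD \<and> Dm t \<in> PSD \<and> Dp t ** Dm t = 0) (at_right 0)"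
    proof eventually_elim
      case (elim t)
      then show ?case
        using eps(2)[OF D_Sym D_comm, of t] by (simp add: Let_def Dp_def Dm_def dist_norm)
    qed
    have "((\<lambda>t. (proj_plus (Z + t *\<^sub>R H + (t\<^sup>2/2) *\<^sub>R W) - U t ** Dp t ** transpose (U t)) /\<^sub>R t\<^sup>2) \<longlongrightarrow> 0) (at_right 0)"
    proof (rule proj_plus_conjugation_approx[OF _ ev])
      show "eventually (\<lambda>t. t\<^sup>2 > 0) (at_right (0::real))" by (rule eventually_at_right_0) simp
      show "(Dp \<longlongrightarrow> X) (at_right 0)" by (rule expands1_tendsto[OF expands2_imp_expands1[OF eDp]])
      then show "(Dm \<longlongrightarrow> X - Z) (at_right 0)"
        unfolding Dm_def by (intro tendsto_diff expands1_tendsto[OF expands2_imp_expands1[OF eD]])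
      have "expands2 (\<lambda>t. V t ** U t) (mat 1) 0 0"
        using expands2_mult[OF eV eU] by (simp add: L_def L'_def matrix_ring_simps flip: scaleR_add_left)
      then show "((\<lambda>t. (transpose (U t) ** U t - mat 1) /\<^sub>R t\<^sup>2) \<longlongrightarrow> 0) (at_right 0)"
        by (simp add: expands2_def expands1_def tU power2_eq_square)
      have "(L ** Z + K ** H1 + G1) + (K ** Z + H1) ** (- K) + Z ** L' = (1/2) *\<^sub>R W"
      proof -
        have "(L ** Z + K ** H1 + G1) + (K ** Z + H1) ** (- K) + Z ** L'
            = c0 + (G1 + (K2 ** Z - Z ** K2))"
          by (simp add: L_def L'_def c0_def matrix_ring_simps)
        also have "G1 + (K2 ** Z - Z ** K2) = Q" by (simp add: G1_def g_def K2_def)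
        finally show ?thesis by (simp add: Q_def)
      qed
      then have "expands2 (\<lambda>t. U t ** D t ** V t) Z H ((1/2) *\<^sub>R W)"
        using expands2_mult[OF expands2_mult[OF eU eD] eV] by (simp add: H1_def matrix_mult_linear_simps)
      from expands2_same_coeffs[OF expands2_quadratic_poly this]
      show "((\<lambda>t. (Z + t *\<^sub>R H + (t\<^sup>2/2) *\<^sub>R W - U t ** (Dp t - Dm t) ** transpose (U t)) /\<^sub>R t\<^sup>2) \<longlongrightarrow> 0) (at_right 0)"
        by (simp add: tU Dm_def)
    qed
    then have approx: "((\<lambda>t. (proj_plus (Z + t *\<^sub>R H + (t\<^sup>2/2) *\<^sub>R W) - U t ** Dp t ** V t) /\<^sub>R t\<^sup>2) \<longlongrightarrow> 0) (at_right 0)"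
      by (simp add: tU)
    have "expands2 (\<lambda>t. U t ** Dp t ** V t) X (K ** X - X ** K + Q1)
       (L ** X + K ** Q1 + (Ep ** G1 ** Ep + q) + (K ** X + Q1) ** (- K) + X ** L')"
      using expands2_mult[OF expands2_mult[OF eU eDp] eV] by (simp add: matrix_mult_linear_simps algebra_simps)
    also have "L ** X + K ** Q1 + (Ep ** G1 ** Ep + q) + (K ** X + Q1) ** (- K) + X ** L' = c + l W + q"
    proof -
      have "2 *\<^sub>R l Q = l W - 2 *\<^sub>R l c0"
        using ll by (simp add: Q_def linear_diff linear_cmul scaleR_right_diff_distrib)
      moreover have "2 *\<^sub>R l Q = Ep ** G1 ** Ep + K2 ** X - X ** K2"
        by (simp add: l_def G1_def K2_def)
      ultimately have "l W - 2 *\<^sub>R l c0 = Ep ** G1 ** Ep + K2 ** X - X ** K2" by simp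
      then show ?thesis
        unfolding c_def by (simp add: L_def L'_def matrix_ring_simps algebra_simps)
    qed
    finally have coeffs: "expands2 (\<lambda>t. U t ** Dp t ** V t) X (K ** X - X ** K + Q1) (c + l W + q)" .
    \<comment> \<open>Here \<open>Upsilon\<close> arises, as twice the kernel block of
      \<open>c0\<close>. Terms with \<open>H1\<close> vanish because \<open>H1\<close> commutes with
      \<open>P0\<close> and \<open>P0 ** K ** P0 = 0\<close>; the surviving term with
      \<open>K ** Z ** K\<close> is expressed by H through
      \<open>P0 ** H ** N = P0 ** K ** (Z ** N)\<close>.\<close>
    have V00_eq: "V00 = (1/2) *\<^sub>R (P0 ** (W - Upsilon Z H) ** P0)"
    proof -
      have PP: "P0 ** (P0 ** A) = P0 ** A" "P0 ** (Z ** A) = 0" "Z ** (P0 ** A) = 0" for A :: "'n mat"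
        by (simp_all add: matrix_mul_assoc P0 matrix_mult_linear_simps)
      have H1P: "H1 ** P0 = P0 ** H1" by (rule commute_P0[OF H1])
      have a: "P0 ** K ** H1 ** P0 = 0"
      proof -
        have "P0 ** K ** H1 ** P0 = P0 ** K ** P0 ** H1" by (simp add: H1P flip: matrix_mul_assoc)
        then show ?thesis by (simp add: PKP matrix_mult_linear_simps)
      qed
      have b: "P0 ** H1 ** K ** P0 = 0"
      proof -
        have "P0 ** H1 ** K ** P0 = H1 ** (P0 ** K ** P0)" by (simp add: H1P[symmetric] matrix_mul_assoc)
        then show ?thesis by (simp add: PKP matrix_mult_linear_simps)
      qed
      have c: "P0 ** H ** (Z ** N) = P0 ** K ** Z"
      proof -
        have "P0 ** H ** (Z ** N) = P0 ** H1 ** (Z ** N) + P0 ** (K ** Z) ** (Z ** N) - P0 ** (Z ** K) ** (Z ** N)"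
          by (simp add: H1_def matrix_ring_simps)
        also have "P0 ** H1 ** (Z ** N) = H1 ** (P0 ** Z) ** N"
          by (simp add: H1P[symmetric] matrix_mul_assoc)
        also have "\<dots> = 0" by (simp add: P0 matrix_mult_linear_simps)
        also have "P0 ** (K ** Z) ** (Z ** N) = P0 ** K ** Z"
          by (simp add: P0 matrix_ring_simps)
        also have "P0 ** (Z ** K) ** (Z ** N) = 0" by (simp add: P0 matrix_mul_assoc matrix_mult_linear_simps)
        finally show ?thesis by simp
      qed
      have c': "P0 ** H ** N = P0 ** K ** (Z ** N)"
      proof -
        have "P0 ** H ** N = P0 ** H ** (Z ** N) ** N" by (simp add: P0 matrix_ring_simps)
        also have "\<dots> = P0 ** K ** Z ** N" by (simp only: c)
        finally show ?thesis by (simp add: matrix_mul_assoc)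
      qed
      have d: "H ** P0 = H1 ** P0 - Z ** (K ** P0)"
        by (simp add: H1_def matrix_ring_simps P0)
      have "P0 ** H ** N ** H ** P0 = P0 ** K ** (Z ** N) ** (H ** P0)"
        by (simp add: c' matrix_mul_assoc)
      also have "\<dots> = P0 ** K ** (Z ** N) ** (P0 ** H1) - P0 ** K ** ((Z ** N) ** Z) ** K ** P0"
        by (simp add: d H1P matrix_mult_linear_simps matrix_mul_assoc)
      also have "P0 ** K ** (Z ** N) ** (P0 ** H1) = 0"
        by (simp add: P0 matrix_ring_simps PP)
      also have "(Z ** N) ** Z = Z" by (simp add: P0 matrix_ring_simps)
      finally have e: "P0 ** K ** Z ** K ** P0 = - (P0 ** H ** N ** H ** P0)" by simp
      have z: "P0 ** (k Q ** Z - Z ** k Q) ** P0 = 0"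
        by (simp add: matrix_ring_simps P0) (simp add: matrix_mul_assoc P0 matrix_mult_linear_simps)
      have "P0 ** c0 ** P0 = P0 ** K ** H1 ** P0 - P0 ** H1 ** K ** P0 - P0 ** K ** Z ** K ** P0"
        by (simp add: c0_def matrix_ring_simps PP P0)
      also have "\<dots> = P0 ** H ** N ** H ** P0" by (simp add: a b e)
      finally have f: "P0 ** c0 ** P0 = P0 ** H ** N ** H ** P0" .
      have U: "P0 ** Upsilon Z H ** P0 = 2 *\<^sub>R (P0 ** H ** N ** H ** P0)"
        by (simp add: Upsilon_def matrix_ring_simps PP P0)
      have "V00 = P0 ** Q ** P0"
        using z by (simp add: V00_def G1_def g_def bounded_bilinear.diff_left[OF bounded_bilinear_matrix_mult]
            bounded_bilinear.diff_right[OF bounded_bilinear_matrix_mult, of P0 Q])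
      also have "\<dots> = (1/2) *\<^sub>R (P0 ** (W - Upsilon Z H) ** P0)"
        by (simp add: Q_def matrix_mult_linear_simps f U scaleR_right_diff_distrib)
      finally show ?thesis .
    qed
    show ?thesis
      using expands2_perturb[OF coeffs approx] by (simp only: q_def H00_def V00_eq)
  qed
  with ll show ?thesis by (intro exI conjI ballI)
qed

end

section \<open>Properties of the second directional derivatives\<close>

lemma proj_plus_firmly_nonexpansive:
  "(norm (proj_plus A - proj_plus B))\<^sup>2 \<le> (proj_plus A - proj_plus B) \<bullet> (A - B)"
  using proj_plus_dot[OF proj_plus_PSD, of A B] proj_plus_dot[OF proj_plus_PSD, of B A]
  by (simp add: power2_norm_eq_inner inner_diff_left inner_diff_right inner_commute)

lemma Upsilon_Sym:
  assumes "Z \<in> Sym" "H \<in> Sym"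
  shows "Upsilon Z H \<in> Sym"
  using assms pinv_kerproj[OF assms(1)] by (simp add: Upsilon_def Sym_iff transpose_simps matrix_mul_assoc)

text \<open>Dividing by \<open>t\<^sup>2/2\<close> doubles the second-order coefficient, and
  homogeneity of \<open>dir1\<close> absorbs the factor 1/2 in its argument.\<close>

lemma dir2_proj_plus_formula:
  assumes Z: "Z \<in> Sym" and H: "H \<in> Sym"
  shows "\<exists>l c. linear l \<and> (\<forall>W\<in>Sym. ((\<lambda>t. (proj_plus (Z + t *\<^sub>R H + (t\<^sup>2/2) *\<^sub>R W) - proj_plus Z
        - t *\<^sub>R dir1 proj_plus Z H) /\<^sub>R (t\<^sup>2/2)) \<longlongrightarrow> dir2 proj_plus Z H W) (at_right 0) \<and> dir2 proj_plus Z H W = c + l W +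
       dir1 proj_plus (kerproj Z ** H ** kerproj Z) (kerproj Z ** (W - Upsilon Z H) ** kerproj Z))"
proof -
  interpret symmetric_matrix Z by standard (rule Z)
  obtain l f1 c where l: "linear l" and ex:
    "\<And>W. W \<in> Sym \<Longrightarrow> expands2 (\<lambda>t. proj_plus (Z + t *\<^sub>R H + (t\<^sup>2/2) *\<^sub>R W)) X f1
       (c + l W + dir1 proj_plus (P0 ** H ** P0) ((1/2) *\<^sub>R (P0 ** (W - Upsilon Z H) ** P0)))"
    using proj_plus_expands2[OF H] by blast
  have "((\<lambda>t. (proj_plus (Z + t *\<^sub>R H) - proj_plus Z) /\<^sub>R t) \<longlongrightarrow> f1) (at_right 0)"
    using expands2_imp_expands1[OF ex[OF Sym_zero]] by (simp add: expands1_def X_def)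
  then have d1: "dir1 proj_plus Z H = f1" unfolding dir1_def by (intro tendsto_Lim) auto
  have lim: "((\<lambda>t. (proj_plus (Z + t *\<^sub>R H + (t\<^sup>2/2) *\<^sub>R W) - proj_plus Z
        - t *\<^sub>R dir1 proj_plus Z H) /\<^sub>R (t\<^sup>2/2)) \<longlongrightarrow> 2 *\<^sub>R c + 2 *\<^sub>R l W +
       dir1 proj_plus (P0 ** H ** P0) (P0 ** (W - Upsilon Z H) ** P0)) (at_right 0)"
    if W: "W \<in> Sym" for W
  proof -
    let ?V = "P0 ** (W - Upsilon Z H) ** P0"
    have "P0 ** H ** P0 \<in> Sym" "?V \<in> Sym"
      using Sym_congr[of H P0] Sym_congr[of "W - Upsilon Z H" P0] H W Upsilon_Sym[OF Z H] P0
      by (simp_all add: Sym_diff)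
    then have hom: "dir1 proj_plus (P0 ** H ** P0) ((1/2) *\<^sub>R ?V) = (1/2) *\<^sub>R dir1 proj_plus (P0 ** H ** P0) ?V"
      by (intro dir1_proj_plus_scaleR) auto
    have "((\<lambda>t. 2 *\<^sub>R (((proj_plus (Z + t *\<^sub>R H + (t\<^sup>2/2) *\<^sub>R W) - X) /\<^sub>R t - f1) /\<^sub>R t)) \<longlongrightarrow>
      2 *\<^sub>R (c + l W + (1/2) *\<^sub>R dir1 proj_plus (P0 ** H ** P0) ?V)) (at_right 0)"
      using ex[OF W] unfolding expands2_def expands1_def hom by (rule tendsto_scaleR[OF tendsto_const])
    moreover have "eventually (\<lambda>t. 2 *\<^sub>R (((proj_plus (Z + t *\<^sub>R H + (t\<^sup>2/2) *\<^sub>R W) - X) /\<^sub>R t - f1) /\<^sub>R t)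
       = (proj_plus (Z + t *\<^sub>R H + (t\<^sup>2/2) *\<^sub>R W) - proj_plus Z - t *\<^sub>R dir1 proj_plus Z H) /\<^sub>R (t\<^sup>2/2)) (at_right 0)"
      by (rule eventually_at_right_0)
         (simp add: d1 X_def scaleR_right_diff_distrib power2_eq_square inverse_eq_divide)
    ultimately show ?thesis by (simp add: tendsto_cong scaleR_right_distrib)
  qed
  have eq: "dir2 proj_plus Z H W = 2 *\<^sub>R c + 2 *\<^sub>R l W +
       dir1 proj_plus (P0 ** H ** P0) (P0 ** (W - Upsilon Z H) ** P0)" if "W \<in> Sym" for W
    unfolding dir2_def using lim[OF that] by (intro tendsto_Lim) auto
  have "linear (\<lambda>W. 2 *\<^sub>R l W)" using l by (auto simp: linear_iff scaleR_right_distrib)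
  moreover have "\<forall>W\<in>Sym. ((\<lambda>t. (proj_plus (Z + t *\<^sub>R H + (t\<^sup>2/2) *\<^sub>R W) - proj_plus Z
        - t *\<^sub>R dir1 proj_plus Z H) /\<^sub>R (t\<^sup>2/2)) \<longlongrightarrow> dir2 proj_plus Z H W) (at_right 0) \<and>
      dir2 proj_plus Z H W = 2 *\<^sub>R c + 2 *\<^sub>R l W +
       dir1 proj_plus (P0 ** H ** P0) (P0 ** (W - Upsilon Z H) ** P0)"
    using lim eq by simp
  ultimately show ?thesis by (intro exI conjI)
qed

lemma dir2_proj_plus_tendsto:
  assumes "Z \<in> Sym" "H \<in> Sym" "W \<in> Sym"
  shows "((\<lambda>t. (proj_plus (Z + t *\<^sub>R H + (t\<^sup>2/2) *\<^sub>R W) - proj_plus Z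
        - t *\<^sub>R dir1 proj_plus Z H) /\<^sub>R (t\<^sup>2/2)) \<longlongrightarrow> dir2 proj_plus Z H W) (at_right 0)"
  using dir2_proj_plus_formula[OF assms(1,2)] assms(3) by blast

text \<open>Centring at \<open>Upsilon\<close> cancels both the constant and the shift in the kernel
  term, leaving a linear map plus \<open>dir1\<close> of the kernel block of V.\<close>

lemma Theta_scaleR:
  assumes Z: "Z \<in> Sym" and H: "H \<in> Sym" and V: "V \<in> Sym" and "r \<ge> 0"
  shows "Theta Z H (r *\<^sub>R V) = r *\<^sub>R Theta Z H V"
proof -
  let ?P = "kerproj Z"
  obtain l c where l: "linear l" and f: "\<And>W. W \<in> Sym \<Longrightarrow> dir2 proj_plus Z H W = c + l W +
       dir1 proj_plus (?P ** H ** ?P) (?P ** (W - Upsilon Z H) ** ?P)"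
    using dir2_proj_plus_formula[OF Z H] by blast
  note U = Upsilon_Sym[OF Z H]
  have PHP: "?P ** H ** ?P \<in> Sym" "?P ** V ** ?P \<in> Sym"
    using Sym_congr[OF H, of ?P] Sym_congr[OF V, of ?P] pinv_kerproj[OF Z] by simp_all
  have zero: "dir1 proj_plus (?P ** H ** ?P) 0 = 0"
    using dir1_proj_plus_scaleR[OF PHP(1) Sym_zero, of 0] by simp
  have Th: "Theta Z H V = l V + dir1 proj_plus (?P ** H ** ?P) (?P ** V ** ?P)" if "V \<in> Sym" for V
    using l that U by (simp add: Theta_def f Sym_add linear_add zero matrix_mult_linear_simps)
  show ?thesis
    using l V \<open>r \<ge> 0\<close> by (simp add: Th Sym_scaleR linear_cmul matrix_mult_linear_simps
        dir1_proj_plus_scaleR[OF PHP] scaleR_right_distrib)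
qed

lemma dir2_proj_plus_Sym:
  assumes Z: "Z \<in> Sym" and H: "H \<in> Sym" and W: "W \<in> Sym"
  shows "dir2 proj_plus Z H W \<in> Sym"
proof -
  have d1: "dir1 proj_plus Z H \<in> Sym"
    by (rule Sym_tendsto[OF dir1_proj_plus_tendsto[OF Z H]])
       (auto intro!: always_eventually Sym_scaleR Sym_diff PSD_Sym[OF proj_plus_PSD])
  show ?thesis
    by (rule Sym_tendsto[OF dir2_proj_plus_tendsto[OF Z H W]])
       (auto intro!: always_eventually Sym_scaleR Sym_diff d1 PSD_Sym[OF proj_plus_PSD])
qed

lemma dir2_proj_plus_firmly_nonexpansive:
  assumes Z: "Z \<in> Sym" and H: "H \<in> Sym" and W: "W1 \<in> Sym" "W2 \<in> Sym"
  shows "(norm (dir2 proj_plus Z H W1 - dir2 proj_plus Z H W2))\<^sup>2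
    \<le> (dir2 proj_plus Z H W1 - dir2 proj_plus Z H W2) \<bullet> (W1 - W2)"
proof -
  define q where "q W t = (proj_plus (Z + t *\<^sub>R H + (t\<^sup>2/2) *\<^sub>R W) - proj_plus Z
        - t *\<^sub>R dir1 proj_plus Z H) /\<^sub>R (t\<^sup>2/2)" for W t
  have lim: "(q W1 \<longlongrightarrow> dir2 proj_plus Z H W1) (at_right 0)" "(q W2 \<longlongrightarrow> dir2 proj_plus Z H W2) (at_right 0)"
    unfolding q_def by (intro dir2_proj_plus_tendsto assms)+
  have "eventually (\<lambda>t. (norm (q W1 t - q W2 t))\<^sup>2 \<le> (q W1 t - q W2 t) \<bullet> (W1 - W2)) (at_right 0)"
  proof (rule eventually_at_right_0)
    fix t :: real assume "t > 0"
    define s where "s = t\<^sup>2/2"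
    have s: "s > 0" using \<open>t > 0\<close> by (simp add: s_def)
    let ?A = "\<lambda>W. Z + t *\<^sub>R H + s *\<^sub>R W"
    have d: "q W1 t - q W2 t = (proj_plus (?A W1) - proj_plus (?A W2)) /\<^sub>R s"
      by (simp add: q_def s_def algebra_simps)
    have "(norm (q W1 t - q W2 t))\<^sup>2 = (norm (proj_plus (?A W1) - proj_plus (?A W2)))\<^sup>2 / s\<^sup>2"
      using s by (simp add: d power_divide divide_inverse power_mult_distrib power_inverse mult.commute)
    also have "\<dots> \<le> ((proj_plus (?A W1) - proj_plus (?A W2)) \<bullet> (?A W1 - ?A W2)) / s\<^sup>2"
      by (intro divide_right_mono proj_plus_firmly_nonexpansive) simp
    also have "?A W1 - ?A W2 = s *\<^sub>R (W1 - W2)" by (simp add: algebra_simps)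
    also have "((proj_plus (?A W1) - proj_plus (?A W2)) \<bullet> (s *\<^sub>R (W1 - W2))) / s\<^sup>2
       = (q W1 t - q W2 t) \<bullet> (W1 - W2)"
      using s by (simp add: d power2_eq_square inverse_eq_divide)
    finally show "(norm (q W1 t - q W2 t))\<^sup>2 \<le> (q W1 t - q W2 t) \<bullet> (W1 - W2)" .
  qed
  then show ?thesis
    by (intro tendsto_le[OF _ _ _ , of "at_right 0"]) (auto intro!: tendsto_intros lim)
qed

lemma dir2_proj_minus:
  assumes Z: "Z \<in> Sym" and H: "H \<in> Sym" and W: "W \<in> Sym"
  shows "dir2 proj_minus Z H W = W - dir2 proj_plus Z H W"
proof -
  have pm: "proj_minus (Z + t *\<^sub>R H + (t\<^sup>2/2) *\<^sub>R V) = Z + t *\<^sub>R H + (t\<^sup>2/2) *\<^sub>R V - proj_plus (Z + t *\<^sub>R H + (t\<^sup>2/2) *\<^sub>R V)"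
    if "V \<in> Sym" for V t
    using that Z H by (intro proj_minus_eq Sym_add Sym_scaleR)
  have "((\<lambda>t. H - (proj_plus (Z + t *\<^sub>R H) - proj_plus Z) /\<^sub>R t) \<longlongrightarrow> H - dir1 proj_plus Z H) (at_right 0)"
    by (intro tendsto_intros dir1_proj_plus_tendsto Z H)
  moreover have "eventually (\<lambda>t. H - (proj_plus (Z + t *\<^sub>R H) - proj_plus Z) /\<^sub>R t
      = (proj_minus (Z + t *\<^sub>R H) - proj_minus Z) /\<^sub>R t) (at_right 0)"
    using pm[OF Sym_zero] proj_minus_eq[OF Z]
    by (intro eventually_at_right_0) (simp add: scaleR_right_diff_distrib scaleR_right_distrib)
  ultimately have "((\<lambda>t. (proj_minus (Z + t *\<^sub>R H) - proj_minus Z) /\<^sub>R t) \<longlongrightarrow> H - dir1 proj_plus Z H) (at_right 0)"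
    by (simp add: tendsto_cong)
  then have d1: "dir1 proj_minus Z H = H - dir1 proj_plus Z H"
    unfolding dir1_def[of proj_minus] by (intro tendsto_Lim) auto
  have "((\<lambda>t. W - (proj_plus (Z + t *\<^sub>R H + (t\<^sup>2/2) *\<^sub>R W) - proj_plus Z
        - t *\<^sub>R dir1 proj_plus Z H) /\<^sub>R (t\<^sup>2/2)) \<longlongrightarrow> W - dir2 proj_plus Z H W) (at_right 0)"
    by (intro tendsto_diff tendsto_const dir2_proj_plus_tendsto assms)
  moreover have "eventually (\<lambda>t. W - (proj_plus (Z + t *\<^sub>R H + (t\<^sup>2/2) *\<^sub>R W) - proj_plus Z
        - t *\<^sub>R dir1 proj_plus Z H) /\<^sub>R (t\<^sup>2/2) =
      (proj_minus (Z + t *\<^sub>R H + (t\<^sup>2/2) *\<^sub>R W) - proj_minus Z - t *\<^sub>R dir1 proj_minus Z H) /\<^sub>R (t\<^sup>2/2)) (at_right 0)"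
    by (intro eventually_at_right_0)
       (simp add: pm[OF W] proj_minus_eq[OF Z] d1 scaleR_right_diff_distrib scaleR_right_distrib)
  ultimately have "((\<lambda>t. (proj_minus (Z + t *\<^sub>R H + (t\<^sup>2/2) *\<^sub>R W) - proj_minus Z
      - t *\<^sub>R dir1 proj_minus Z H) /\<^sub>R (t\<^sup>2/2)) \<longlongrightarrow> W - dir2 proj_plus Z H W) (at_right 0)"
    by (simp add: tendsto_cong)
  then show ?thesis unfolding dir2_def[of proj_minus] by (intro tendsto_Lim) auto
qed

section \<open>Iterations of firmly nonexpansive maps\<close>

text \<open>Minty's parametrization: the resolvent points \<open>M x\<^sub>t = - t x\<^sub>t\<close> exist by Banach's fixed point
  theorem, and monotonicity of \<open>M\<close> at \<open>x\<^sub>t\<close> passes to a cluster point of \<open>M x\<^sub>t\<close> as \<open>t \<rightarrow> 0\<close>.\<close>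
lemma minimal_displacement_vector:
  fixes M :: "'a::euclidean_space \<Rightarrow> 'a"
  assumes V: "subspace V" and M: "\<And>x. x \<in> V \<Longrightarrow> M x \<in> V"
    and firm: "\<And>x y. x \<in> V \<Longrightarrow> y \<in> V \<Longrightarrow> (norm (M x - M y))\<^sup>2 \<le> (M x - M y) \<bullet> (x - y)"
  shows "\<exists>v\<in>closure (M ` V). \<forall>y\<in>V. (norm v)\<^sup>2 \<le> M y \<bullet> v"
proof -
  have fix_pt: "\<exists>x\<in>V. M x = - t *\<^sub>R x" if t: "t > 0" for t
  proof -
    \<comment> \<open>Its fixed points solve \<open>M x = - t *\<^sub>R x\<close>. Subtracting M
      from the identity gives a nonexpansive map, so the prefactor makes f a contraction.\<close>
    define f where "f x = (1 / (1 + t)) *\<^sub>R (x - M x)" for x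
    have "\<exists>!x\<in>V. f x = x"
    proof (rule Banach_fix)
      show "complete V" using V by (simp add: closed_subspace complete_eq_closed)
      show "V \<noteq> {}" using V subspace_0 by auto
      show "0 \<le> 1 / (1 + t)" "1 / (1 + t) < 1" using t by auto
      show "f ` V \<subseteq> V" using V M by (auto simp: f_def intro!: subspace_scale subspace_diff)
      fix x y assume xy: "x \<in> V" "y \<in> V"
      let ?a = "M x - M y" and ?b = "x - y"
      have "(norm (?b - ?a))\<^sup>2 = (norm ?b)\<^sup>2 - 2 * (?a \<bullet> ?b) + (norm ?a)\<^sup>2"
        by (simp add: power2_norm_eq_inner inner_diff_left inner_diff_right inner_commute)
      also have "\<dots> \<le> (norm ?b)\<^sup>2" using firm[OF xy] zero_le_power2[of "norm ?a"] by linarith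
      finally have "norm (?b - ?a) \<le> norm ?b" by (rule power2_le_imp_le) simp
      moreover have "f x - f y = (1 / (1 + t)) *\<^sub>R (?b - ?a)"
        by (simp add: f_def algebra_simps)
      ultimately show "dist (f x) (f y) \<le> 1 / (1 + t) * dist x y"
        using t by (simp add: dist_norm divide_right_mono)
    qed
    then obtain x where x: "x \<in> V" "f x = x" by blast
    have "(1 + t) *\<^sub>R f x = x - M x" using t by (simp add: f_def)
    then have "M x = - t *\<^sub>R x" using x(2) by (simp add: algebra_simps eq_neg_iff_add_eq_0)
    with x show ?thesis by blast
  qed
  define t where "t n = 1 / real (Suc n)" for n
  have tpos: "t n > 0" for n by (simp add: t_def)
  have "\<forall>n. \<exists>x. x \<in> V \<and> M x = - t n *\<^sub>R x" using fix_pt[OF tpos] by blast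
  then obtain x where x: "\<And>n. x n \<in> V" "\<And>n. M (x n) = - t n *\<^sub>R x n" by metis
  define u where "u n = M (x n)" for n
  \<comment> \<open>The points \<open>x n\<close> may be unbounded. Multiplying monotonicity by
    \<open>t n\<close> replaces them by \<open>- u n\<close>, which is bounded.\<close>
  have key: "(norm (u n))\<^sup>2 \<le> M y \<bullet> u n - t n * (u n \<bullet> y) + t n * (M y \<bullet> y)" if y: "y \<in> V" for n y
  proof -
    have "0 \<le> (u n - M y) \<bullet> (x n - y)"
      using firm[OF x(1)[of n] y] zero_le_power2 unfolding u_def by (meson order_trans)
    then have "0 \<le> t n * ((u n - M y) \<bullet> (x n - y))" using tpos[of n] by (simp add: less_imp_le)
    also have "\<dots> = (u n - M y) \<bullet> (t n *\<^sub>R x n - t n *\<^sub>R y)" by (simp add: inner_diff_right algebra_simps)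
    also have "t n *\<^sub>R x n = - u n" using x(2)[of n] by (simp add: u_def)
    finally show ?thesis by (simp add: power2_norm_eq_inner inner_diff_left inner_diff_right inner_commute algebra_simps)
  qed
  have "norm (u n) \<le> norm (M 0)" for n
  proof (cases "u n = 0")
    case False
    have "norm (u n) * norm (u n) \<le> M 0 \<bullet> u n"
      using key[OF subspace_0[OF V], of n] by (simp add: power2_eq_square)
    also have "\<dots> \<le> norm (M 0) * norm (u n)" by (rule norm_cauchy_schwarz)
    finally show ?thesis using False by simp
  qed simp
  then have "bounded (range u)" by (auto simp: bounded_iff)
  then obtain v r where r: "strict_mono r" "(u \<circ> r) \<longlonglongrightarrow> v"
    using bounded_imp_convergent_subsequence by blast
  have t0: "(t \<circ> r) \<longlonglongrightarrow> 0"
    using LIMSEQ_subseq_LIMSEQ[OF _ r(1)] lim_1_over_n LIMSEQ_Suc unfolding t_def by blast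
  have "v \<in> closure (M ` V)"
    unfolding closure_sequential using r(2) x(1) by (intro exI[of _ "u \<circ> r"]) (auto simp: u_def)
  moreover have "(norm v)\<^sup>2 \<le> M y \<bullet> v" if y: "y \<in> V" for y
  proof -
    have "(\<lambda>n. M y \<bullet> (u \<circ> r) n - (t \<circ> r) n * ((u \<circ> r) n \<bullet> y) + (t \<circ> r) n * (M y \<bullet> y))
        \<longlonglongrightarrow> M y \<bullet> v - 0 * (v \<bullet> y) + 0 * (M y \<bullet> y)"
      by (intro tendsto_intros r t0)
    moreover have "(\<lambda>n. (norm ((u \<circ> r) n))\<^sup>2) \<longlonglongrightarrow> (norm v)\<^sup>2" by (intro tendsto_intros r)
    ultimately show ?thesis using key[OF y] by (intro LIMSEQ_le) auto
  qed
  ultimately show ?thesis by blast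
qed

text \<open>The inequality extends to the closure of B and bounds the squared distance from u to v
  by the difference of their squared norms, so a nearest point cannot differ from
  \<open>a + v\<close>.\<close>

lemma closest_point_eq_min_norm:
  fixes v :: "'a::euclidean_space"
  assumes v: "v \<in> closure B" and min: "\<And>u. u \<in> B \<Longrightarrow> (norm v)\<^sup>2 \<le> u \<bullet> v"
  shows "closest_point (closure ((+) a ` B)) a = a + v"
proof -
  have cl: "closure ((+) a ` B) = (+) a ` closure B" by (rule closure_translation)
  have min': "(norm v)\<^sup>2 \<le> u \<bullet> v" if "u \<in> closure B" for u
  proof -
    have "closure B \<subseteq> {u. v \<bullet> u \<ge> (norm v)\<^sup>2}"
      using min by (intro closure_minimal closed_halfspace_ge) (auto simp: inner_commute)
    then show ?thesis using that by (auto simp: inner_commute)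
  qed
  let ?c = "closest_point (closure ((+) a ` B)) a"
  have ne: "closure ((+) a ` B) \<noteq> {}" using v cl by auto
  have "?c \<in> (+) a ` closure B" using closest_point_in_set[OF closed_closure ne] cl by simp
  then obtain u where u: "u \<in> closure B" "?c = a + u" by auto
  have "dist a ?c \<le> dist a (a + v)"
    using v cl by (intro closest_point_le closed_closure) auto
  then have "norm u \<le> norm v" by (simp add: u(2) dist_norm)
  then have "(norm u)\<^sup>2 \<le> (norm v)\<^sup>2" by (rule power_mono) simp
  moreover have "(norm (u - v))\<^sup>2 = (norm u)\<^sup>2 - 2 * (u \<bullet> v) + (norm v)\<^sup>2"
    by (simp add: power2_norm_eq_inner inner_diff_left inner_diff_right inner_commute)
  ultimately have "(norm (u - v))\<^sup>2 \<le> 0" using min'[OF u(1)] by linarith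
  then have "u = v" by simp
  then show ?thesis using u(2) by simp
qed

lemma LIMSEQ_norm_square_squeeze:
  assumes "f \<longlonglongrightarrow> (0::real)" "\<And>n. (norm (g n))\<^sup>2 \<le> f n"
  shows "(\<lambda>n. (norm (g n))\<^sup>2) \<longlonglongrightarrow> 0"
  by (rule tendsto_sandwich[OF _ _ tendsto_const assms(1)]) (simp_all add: assms(2))

text \<open>Compare with an orbit started where the displacement nearly attains the norm of v: along
  it displacement norms never increase. Displacements of two orbits merge, since the squared
  distances decrease and bound the squared differences by consecutive gaps. Thus the norms converge
  to that of v, and the minimality inequality upgrades this to convergence of the vectors.\<close>

lemma firmly_nonexpansive_displacement_limit:
  fixes M :: "'a::euclidean_space \<Rightarrow> 'a"
  assumes V: "subspace V" and M: "\<And>x. x \<in> V \<Longrightarrow> M x \<in> V"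
    and firm: "\<And>x y. x \<in> V \<Longrightarrow> y \<in> V \<Longrightarrow> (norm (M x - M y))\<^sup>2 \<le> (M x - M y) \<bullet> (x - y)"
    and v: "v \<in> closure (M ` V)" and min: "\<And>y. y \<in> V \<Longrightarrow> (norm v)\<^sup>2 \<le> M y \<bullet> v"
    and x0: "x 0 \<in> V" and x: "\<And>n. x (Suc n) = x n - M (x n)"
  shows "(\<lambda>n. M (x n)) \<longlonglongrightarrow> v"
proof -
  have orbit: "y n \<in> V" if "y 0 \<in> V" "\<And>n. y (Suc n) = y n - M (y n)" for y n
    using that by (induction n) (auto intro: subspace_diff[OF V] M)
  have step: "(norm (M a - M b))\<^sup>2 \<le> (norm (a - b))\<^sup>2 - (norm ((a - M a) - (b - M b)))\<^sup>2"
    if "a \<in> V" "b \<in> V" for a b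
    using firm[OF that]
    by (simp add: power2_norm_eq_inner inner_diff_left inner_diff_right inner_commute)
  have diff0: "(\<lambda>n. M (x n) - M (y n)) \<longlonglongrightarrow> 0" if y: "y 0 \<in> V" "\<And>n. y (Suc n) = y n - M (y n)" for y
  proof -
    have s: "(norm (M (x n) - M (y n)))\<^sup>2 \<le> (norm (x n - y n))\<^sup>2 - (norm (x (Suc n) - y (Suc n)))\<^sup>2" for n
      using step[OF orbit[OF x0 x] orbit[OF y], of n n] by (simp add: x y(2))
    let ?d = "\<lambda>n. (norm (x n - y n))\<^sup>2"
    have "decseq ?d" using s by (intro decseq_SucI) (smt (verit) zero_le_power2)
    then obtain L where L: "?d \<longlonglongrightarrow> L"
      by (rule decseq_convergent[where B = 0]) auto
    have "(\<lambda>n. ?d n - ?d (Suc n)) \<longlonglongrightarrow> L - L" by (intro tendsto_diff L LIMSEQ_Suc)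
    then have "(\<lambda>n. ?d n - ?d (Suc n)) \<longlonglongrightarrow> 0" by simp
    then have "(\<lambda>n. (norm (M (x n) - M (y n)))\<^sup>2) \<longlonglongrightarrow> 0"
      by (rule LIMSEQ_norm_square_squeeze[OF _ s])
    then have "(\<lambda>n. sqrt ((norm (M (x n) - M (y n)))\<^sup>2)) \<longlonglongrightarrow> sqrt 0" by (rule tendsto_real_sqrt)
    then show ?thesis by (simp add: tendsto_norm_zero_iff)
  qed
  have dec: "norm (M (y (Suc n))) \<le> norm (M (y n))" if y: "y 0 \<in> V" "\<And>n. y (Suc n) = y n - M (y n)" for y n
  proof -
    let ?a = "M (y n)" and ?b = "M (y (Suc n))"
    have "(norm (?a - ?b))\<^sup>2 \<le> (?a - ?b) \<bullet> (y n - y (Suc n))"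
      by (rule firm[OF orbit[OF y] orbit[OF y]])
    then have "(norm ?b)\<^sup>2 \<le> ?b \<bullet> ?a"
      by (simp add: y(2) power2_norm_eq_inner inner_diff_left inner_diff_right inner_commute)
    also have "\<dots> \<le> norm ?b * norm ?a" by (rule norm_cauchy_schwarz)
    finally show ?thesis by (cases "?b = 0") (auto simp: power2_eq_square)
  qed
  have lim: "(\<lambda>n. (norm (M (x n)))\<^sup>2) \<longlonglongrightarrow> (norm v)\<^sup>2"
  proof (rule LIMSEQ_I)
    fix e :: real assume e: "e > 0"
    have lower: "norm v \<le> norm (M (x n))" for n
    proof -
      have "norm v * norm v \<le> norm (M (x n)) * norm v"
        using min[OF orbit[OF x0 x], of n] norm_cauchy_schwarz[of "M (x n)" v]
        by (simp add: power2_eq_square)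
      then show ?thesis by (cases "v = 0") auto
    qed
    \<comment> \<open>The factor \<open>2 * norm v + 2\<close> bounds the sum in the factored
      difference of squares, using that delta is at most 1; the extra 2 leaves room for strict
      inequality.\<close>
    define \<delta> where "\<delta> = min 1 (e / (2 * (2 * norm v + 2)))"
    have d: "\<delta> > 0" "\<delta> \<le> 1" "2 * (\<delta> * (2 * norm v + 2)) \<le> e"
    proof -
      have p: "2 * norm v + 2 > 0" by (simp add: add_nonneg_pos)
      show "\<delta> > 0" "\<delta> \<le> 1" using e p by (auto simp: \<delta>_def)
      have "\<delta> \<le> e / (2 * (2 * norm v + 2))" by (simp add: \<delta>_def)
      then show "2 * (\<delta> * (2 * norm v + 2)) \<le> e" using p by (simp add: field_simps)
    qed
    obtain z where z: "z \<in> V" "dist (M z) v < \<delta> / 2"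
      using v d(1) unfolding closure_approachable by (metis half_gt_zero imageE)
    define y where "y n = ((\<lambda>a. a - M a) ^^ n) z" for n
    have y: "y 0 \<in> V" "\<And>n. y (Suc n) = y n - M (y n)" using z by (auto simp: y_def)
    have yb: "norm (M (y n)) \<le> norm (M z)" for n
      by (induction n) (use dec[OF y] in \<open>auto simp: y_def intro: order_trans\<close>)
    have "norm (M z) < norm v + \<delta> / 2" using z(2) norm_triangle_ineq2[of "M z" v] by (simp add: dist_norm)
    obtain N where N: "\<And>n. n \<ge> N \<Longrightarrow> norm (M (x n) - M (y n)) < \<delta> / 2"
      using LIMSEQ_D[OF diff0[OF y], of "\<delta>/2"] d(1) by auto
    have "norm ((norm (M (x n)))\<^sup>2 - (norm v)\<^sup>2) < e" if "n \<ge> N" for n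
    proof -
      let ?p = "norm (M (x n))"
      have up: "?p < norm v + \<delta>"
        using N[OF that] yb[of n] \<open>norm (M z) < norm v + \<delta> / 2\<close> norm_triangle_ineq2[of "M (x n)" "M (y n)"]
        by linarith
      have "?p\<^sup>2 - (norm v)\<^sup>2 = (?p - norm v) * (?p + norm v)" by (simp add: power2_eq_square algebra_simps)
      also have "\<dots> \<le> \<delta> * (2 * norm v + 2)"
        using up lower[of n] d(1,2) by (intro mult_mono) auto
      finally have "?p\<^sup>2 - (norm v)\<^sup>2 \<le> \<delta> * (2 * norm v + 2)" .
      moreover have "\<delta> * (2 * norm v + 2) > 0" using d(1) by (simp add: add_nonneg_pos)
      ultimately have "?p\<^sup>2 - (norm v)\<^sup>2 < e" using d(3) by linarith
      moreover have "(norm v)\<^sup>2 \<le> ?p\<^sup>2" by (intro power_mono lower) simp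
      ultimately show ?thesis by simp
    qed
    then show "\<exists>no. \<forall>n\<ge>no. norm ((norm (M (x n)))\<^sup>2 - (norm v)\<^sup>2) < e" by blast
  qed
  have "(norm (M (x n) - v))\<^sup>2 \<le> (norm (M (x n)))\<^sup>2 - (norm v)\<^sup>2" for n
    using min[OF orbit[of x n, OF x0 x]]
    by (simp add: power2_norm_eq_inner inner_diff_left inner_diff_right inner_commute)
  moreover have "(\<lambda>n. (norm (M (x n)))\<^sup>2 - (norm v)\<^sup>2) \<longlonglongrightarrow> 0" using lim by (simp add: LIM_zero_iff)
  ultimately have "(\<lambda>n. (norm (M (x n) - v))\<^sup>2) \<longlonglongrightarrow> 0"
    by (rule LIMSEQ_norm_square_squeeze[rotated])
  then have "(\<lambda>n. sqrt ((norm (M (x n) - v))\<^sup>2)) \<longlonglongrightarrow> sqrt 0" by (rule tendsto_real_sqrt)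
  then show ?thesis by (simp add: tendsto_norm_zero_iff LIM_zero_iff)
qed

text \<open>The Stolz-Cesaro theorem for vectors. It is what links limits of increments to the
  scaled iterates on which homogeneity acts.\<close>

lemma LIMSEQ_quotient_of_differences:
  fixes x :: "nat \<Rightarrow> 'a::real_normed_vector"
  assumes "(\<lambda>n. x (Suc n) - x n) \<longlonglongrightarrow> a"
  shows "(\<lambda>n. x n /\<^sub>R real n) \<longlonglongrightarrow> a"
proof (rule LIMSEQ_I)
  fix e :: real assume e: "e > 0"
  define y where "y n = x n - real n *\<^sub>R a" for n
  have yS: "y (Suc n) - y n = (x (Suc n) - x n) - a" for n by (simp add: y_def algebra_simps)
  obtain N where N: "\<And>n. n \<ge> N \<Longrightarrow> norm (y (Suc n) - y n) < e / 2"
    using LIMSEQ_D[OF assms, of "e/2"] e by (auto simp: yS)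
  have b: "norm (y (N + k)) \<le> norm (y N) + real k * (e / 2)" for k
  proof (induction k)
    case (Suc k)
    have "norm (y (N + Suc k)) \<le> norm (y (N + k)) + norm (y (Suc (N + k)) - y (N + k))"
      using norm_triangle_sub[of "y (N + Suc k)" "y (N + k)"] by simp
    then show ?case using Suc N[of "N + k"] by (simp add: algebra_simps add_divide_distrib)
  qed simp
  obtain N' :: nat where N': "real N' > norm (y N) / (e / 2)" using reals_Archimedean2 by blast
  have "norm (x n /\<^sub>R real n - a) < e" if n: "n \<ge> max N (Suc N')" for n
  proof -
    have n0: "real n > 0" using n by simp
    have "norm (y n) \<le> norm (y N) + real (n - N) * (e / 2)" using b[of "n - N"] n by simp
    also have "\<dots> \<le> norm (y N) + real n * (e / 2)" using e by simp
    also have "norm (y N) < real n * (e / 2)"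
    proof -
      have "norm (y N) < real N' * (e / 2)" using N' e by (simp add: field_simps)
      also have "\<dots> \<le> real n * (e / 2)" using n e by (intro mult_right_mono) auto
      finally show ?thesis .
    qed
    finally have "norm (y n) < real n * e" by (simp add: mult.commute)
    moreover have "x n /\<^sub>R real n - a = y n /\<^sub>R real n" using n0 by (simp add: y_def algebra_simps)
    ultimately show ?thesis using n0 by (simp add: field_simps)
  qed
  then show "\<exists>no. \<forall>n\<ge>no. norm (x n /\<^sub>R real n - a) < e" by blast
qed

text \<open>The squared norms of consecutive displacements differ by
  \<open>\<parallel>P a\<parallel>\<^sup>2 + \<parallel>b - P b\<parallel>\<^sup>2 + 2 \<langle>a, b\<rangle>\<close>, so all three terms vanish in the limit.\<close>
lemma complementary_components_limit:
  fixes P :: "'a::real_inner \<Rightarrow> 'a"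
  assumes P: "bounded_linear P" "\<And>x. P (P x) = P x" "\<And>x y. P x \<bullet> y = x \<bullet> P y"
    and ab: "\<And>n. a n \<bullet> b n \<ge> 0"
    and d: "\<And>n. d n = a n + b n" "\<And>n. d (Suc n) = P (b n) + (a n - P (a n))" "d \<longlonglongrightarrow> \<phi>"
  shows "a \<longlonglongrightarrow> \<phi> - P \<phi>" "b \<longlonglongrightarrow> P \<phi>"
proof -
  interpret P: bounded_linear P by (rule P(1))
  have orth: "P x \<bullet> (y - P y) = 0" for x y using P(2,3) by (simp add: P.diff)
  have split: "(norm x)\<^sup>2 = (norm (P x))\<^sup>2 + (norm (x - P x))\<^sup>2" for x
    using orth[of x x] by (simp add: power2_norm_eq_inner inner_diff_left inner_diff_right inner_commute)
  have "(norm (P (a n)))\<^sup>2 \<le> (norm (d n))\<^sup>2 - (norm (d (Suc n)))\<^sup>2" for n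
  proof -
    have "(norm (d (Suc n)))\<^sup>2 = (norm (P (b n)))\<^sup>2 + (norm (a n - P (a n)))\<^sup>2"
      unfolding d(2) using orth[of "b n" "a n"]
      by (simp add: power2_norm_eq_inner inner_add_left inner_add_right inner_commute)
    moreover have "(norm (d n))\<^sup>2 = (norm (a n))\<^sup>2 + (norm (b n))\<^sup>2 + 2 * (a n \<bullet> b n)"
      unfolding d(1) by (simp add: power2_norm_eq_inner inner_add_left inner_add_right inner_commute)
    ultimately show ?thesis using split[of "a n"] split[of "b n"] ab[of n] zero_le_power2[of "norm (b n - P (b n))"]
      by linarith
  qed
  moreover have "(\<lambda>n. (norm (d n))\<^sup>2 - (norm (d (Suc n)))\<^sup>2) \<longlonglongrightarrow> (norm \<phi>)\<^sup>2 - (norm \<phi>)\<^sup>2"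
    by (intro tendsto_intros d LIMSEQ_Suc)
  then have "(\<lambda>n. (norm (d n))\<^sup>2 - (norm (d (Suc n)))\<^sup>2) \<longlonglongrightarrow> 0" by simp
  ultimately have "(\<lambda>n. (norm (P (a n)))\<^sup>2) \<longlonglongrightarrow> 0"
    by (rule LIMSEQ_norm_square_squeeze[rotated])
  then have "(\<lambda>n. sqrt ((norm (P (a n)))\<^sup>2)) \<longlonglongrightarrow> sqrt 0" by (rule tendsto_real_sqrt)
  then have Pa: "(\<lambda>n. P (a n)) \<longlonglongrightarrow> 0" by (simp add: tendsto_norm_zero_iff)
  \<comment> \<open>The complementary component of each increment is inherited from the preceding a,
    so with \<open>P (a n)\<close> vanishing the limit of d determines that of a.\<close>
  have "d (Suc n) - P (d (Suc n)) = a n - P (a n)" for n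
    by (simp add: d(2) P.add P.diff P(2))
  moreover have "(\<lambda>n. d (Suc n) - P (d (Suc n))) \<longlonglongrightarrow> \<phi> - P \<phi>"
    by (intro tendsto_diff P.tendsto LIMSEQ_Suc d)
  ultimately have "(\<lambda>n. P (a n) + (a n - P (a n))) \<longlonglongrightarrow> 0 + (\<phi> - P \<phi>)"
    by (intro tendsto_add Pa) simp
  then show a: "a \<longlonglongrightarrow> \<phi> - P \<phi>" by simp
  have "(\<lambda>n. d n - a n) \<longlonglongrightarrow> \<phi> - (\<phi> - P \<phi>)" by (intro tendsto_diff d a)
  then show "b \<longlonglongrightarrow> P \<phi>" by (simp add: d(1))
qed

section \<open>The orthogonal projector of the constraints and the limits of the iteration\<close>

lemma projP_properties:
  fixes A :: "'m::finite \<Rightarrow> 'n::finite mat"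
  assumes A: "\<And>i. A i \<in> Sym" and A1: "\<forall>c. \<exists>X\<in>Sym. opA A X = c"
  shows "linear (projP A)" "projP A (projP A X) = projP A X" "projP A X \<bullet> Y = X \<bullet> projP A Y"
    "projP A X \<in> Sym"
proof -
  let ?G = "gramA A"
  have inp: "inprod (A i) X = A i \<bullet> X" for i X
    using A[of i] by (simp add: inprod_def inner_eq_trace Sym_iff)
  have op: "opA A X = (\<chi> i. A i \<bullet> X)" for X by (simp add: opA_def inp)
  have lop: "linear (opA A)" by (auto simp: linear_iff op vec_eq_iff inner_add_right)
  have ladj: "linear (adjA A)"
    by (auto simp: linear_iff adjA_def scaleR_add_left sum.distrib scaleR_sum_right)
  have adj: "adjA A y \<bullet> X = y \<bullet> opA A X" for y X
    by (simp add: adjA_def op inner_sum_left inner_vec_def[of y])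
  have gram: "?G *v y = opA A (adjA A y)" for y
    by (simp add: vec_eq_iff gramA_def op adjA_def matrix_vector_mult_def inp inner_sum_right mult.commute)
  \<comment> \<open>Surjectivity of the constraint map makes its adjoint injective, hence the Gram
    matrix invertible; only then is \<open>matrix_inv\<close> a genuine inverse.\<close>
  have "y = 0" if "?G *v y = 0" for y
  proof -
    have "adjA A y \<bullet> adjA A y = 0" using that by (simp add: adj gram)
    then have z: "adjA A y = 0" by simp
    obtain X where "opA A X = y" using A1 by blast
    then have "y \<bullet> y = 0" using adj[of y X] z by simp
    then show ?thesis by simp
  qed
  then have "invertible ?G"
    by (simp add: invertible_left_inverse matrix_left_invertible_ker)
  then have inv: "?G ** matrix_inv ?G = mat 1"
    unfolding invertible_def matrix_inv_def by (rule someI2_ex) simp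
  have opP: "opA A (projP A X) = opA A X" for X
    by (simp add: projP_def gram[symmetric] matrix_vector_mul_assoc inv)
  show "linear (projP A)"
    using linear_compose[OF linear_compose[OF lop matrix_vector_mul_linear] ladj]
    by (simp add: projP_def[abs_def] o_def)
  show "projP A (projP A X) = projP A X" for X by (subst (1 2) projP_def) (simp add: opP)
  have "projP A X \<bullet> (Y - projP A Y) = 0" for X Y
    using lop by (subst projP_def) (simp add: adj linear_diff opP)
  then have "projP A X \<bullet> Y = projP A X \<bullet> projP A Y" for X Y by (simp add: inner_diff_right)
  then show "projP A X \<bullet> Y = X \<bullet> projP A Y" by (metis inner_commute)
  show "projP A X \<in> Sym"
    unfolding projP_def adjA_def by (intro subspace_sum[OF subspace_Sym] Sym_scaleR A)
qed

text \<open>With \<open>F = \<Pi>\<^sub>+''(Z; H, \<cdot>)\<close> the iteration map \<open>W + \<delta>''(W) = P (W - F W) + P\<^sup>\<bottom> (F W)\<close> is of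
  Douglas--Rachford type; firm nonexpansiveness of \<open>F\<close> passes to it.\<close>
lemma reflected_firmly_nonexpansive:
  fixes P :: "'a::real_inner \<Rightarrow> 'a"
  assumes P: "linear P" "\<And>x. P (P x) = P x" "\<And>x y. P x \<bullet> y = x \<bullet> P y"
    and f: "(norm f)\<^sup>2 \<le> f \<bullet> w"
  defines "m \<equiv> P f + ((w - f) - P (w - f))"
  shows "(norm m)\<^sup>2 \<le> m \<bullet> w"
proof -
  let ?g = "w - f"
  have orth: "P x \<bullet> (y - P y) = 0" for x y using P by (simp add: linear_diff)
  \<comment> \<open>The vectors m and \<open>w - m\<close> are f and \<open>w - f\<close> with their
    complementary components exchanged, which preserves the inner product.\<close>
  have "m \<bullet> (w - m) = f \<bullet> ?g"
  proof -
    have "w - m = P ?g + (f - P f)" using P(1) by (simp add: m_def linear_diff)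
    moreover have "(P f + (?g - P ?g)) \<bullet> (P ?g + (f - P f)) = P f \<bullet> P ?g + (?g - P ?g) \<bullet> (f - P f)"
      using orth[of f f] orth[of ?g ?g] by (simp add: inner_add_left inner_add_right inner_commute)
    moreover have "f \<bullet> ?g = P f \<bullet> P ?g + (?g - P ?g) \<bullet> (f - P f)"
    proof -
      have "f \<bullet> ?g = (P f + (f - P f)) \<bullet> (P ?g + (?g - P ?g))" by simp
      also have "\<dots> = P f \<bullet> P ?g + (f - P f) \<bullet> (?g - P ?g)"
        unfolding inner_add_left inner_add_right using orth[of f ?g] orth[of ?g f]
        by (simp add: inner_commute)
      finally show ?thesis by (simp add: inner_commute)
    qed
    ultimately show ?thesis by (simp only: m_def)
  qed
  moreover have "f \<bullet> ?g \<ge> 0" using f by (simp add: inner_diff_right power2_norm_eq_inner)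
  ultimately show ?thesis by (simp add: inner_diff_right power2_norm_eq_inner)
qed

theorem theorem5p5:
  fixes C :: "'n::finite mat" and A :: "'m::finite \<Rightarrow> 'n mat" and b :: "real^'m"
    and \<sigma> :: real and Zbar Hbar :: "'n mat" and W :: "nat \<Rightarrow> 'n mat"
  assumes C_sym: "C \<in> Sym" and A_sym: "\<And>i. A i \<in> Sym"
    and A1: "\<forall>c. \<exists>X\<in>Sym. opA A X = c"
    and A2: "\<exists>X y S. KKT C A b X y S \<and> rank X + rank S = CARD('n)"
    and sigma_pos: "\<sigma> > 0"
    and Zbar: "Zbar \<in> Zstar \<sigma> C A b"
    and Hbar: "Hbar \<in> crit A Zbar"
    and W0: "W 0 \<in> Sym"
    and W_rec: "\<And>k. W (Suc k) = W k + delta2 A Zbar Hbar (W k)"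
  shows "\<exists>phiX phiS L.
     ((\<lambda>k. dir2 proj_plus Zbar Hbar (W (Suc k)) - dir2 proj_plus Zbar Hbar (W k))
        \<longlonglongrightarrow> phiX)
   \<and> ((\<lambda>k. dir2 proj_minus Zbar Hbar (W (Suc k)) - dir2 proj_minus Zbar Hbar (W k))
        \<longlonglongrightarrow> L)
   \<and> phiS = - (1/\<sigma>) *\<^sub>R L
   \<and> phiX = Theta Zbar Hbar (phi A Zbar Hbar)
   \<and> phiS = - (1/\<sigma>) *\<^sub>R Theta_perp Zbar Hbar (phi A Zbar Hbar)
   \<and> phi A Zbar Hbar = phiX - \<sigma> *\<^sub>R phiS"
proof -
  have Z: "Zbar \<in> Sym"
    using Zbar by (auto simp: Zstar_def Xstar_def Sstar_def KKT_def intro!: Sym_diff Sym_scaleR dest: PSD_Sym)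
  have H: "Hbar \<in> Sym" using Hbar by (simp add: crit_def)
  define P where "P = projP A"
  note P = projP_properties[OF A_sym A1, folded P_def]
  define F where "F = dir2 proj_plus Zbar Hbar"
  define G where "G = dir2 proj_minus Zbar Hbar"
  define U where "U = Upsilon Zbar Hbar"
  have USym: "U \<in> Sym" unfolding U_def by (rule Upsilon_Sym[OF Z H])
  have G: "G V = V - F V" if "V \<in> Sym" for V
    unfolding F_def G_def by (rule dir2_proj_minus[OF Z H that])
  have F_Sym: "F V \<in> Sym" if "V \<in> Sym" for V
    unfolding F_def by (rule dir2_proj_plus_Sym[OF Z H that])
  have F_firm: "(norm (F V - F V'))\<^sup>2 \<le> (F V - F V') \<bullet> (V - V')" if "V \<in> Sym" "V' \<in> Sym" for V V'
    unfolding F_def by (rule dir2_proj_plus_firmly_nonexpansive[OF Z H that])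
  \<comment> \<open>On symmetric matrices M is \<open>- delta2\<close>, so the iteration subtracts M
    and its increments tend to \<open>- v\<close>.\<close>
  define M where "M V = P (F V) + ((V - F V) - P (V - F V))" for V
  have delta: "delta2 A Zbar Hbar V = - M V" if "V \<in> Sym" for V
    using G[OF that] by (simp add: delta2_def projPperp_def M_def F_def G_def P_def)
  have M_Sym: "M V \<in> Sym" if "V \<in> Sym" for V
    unfolding M_def by (intro Sym_add Sym_diff P F_Sym that)
  have M_firm: "(norm (M V - M V'))\<^sup>2 \<le> (M V - M V') \<bullet> (V - V')" if "V \<in> Sym" "V' \<in> Sym" for V V'
  proof -
    have "M V - M V' = P (F V - F V') + (((V - V') - (F V - F V')) - P ((V - V') - (F V - F V')))"
      using P(1) by (simp add: M_def linear_diff linear_add algebra_simps)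
    then show ?thesis
      using reflected_firmly_nonexpansive[OF P(1-3) F_firm[OF that]] by simp
  qed
  obtain v where v: "v \<in> closure (M ` Sym)" "\<And>y. y \<in> Sym \<Longrightarrow> (norm v)\<^sup>2 \<le> M y \<bullet> v"
    using minimal_displacement_vector[OF subspace_Sym M_Sym M_firm] by blast
  have W_Sym: "W k \<in> Sym" for k
    by (induction k) (auto simp: W0 W_rec delta intro: Sym_add Sym_diff Sym_uminus M_Sym)
  have W_step: "W (Suc k) = W k - M (W k)" for k by (simp add: W_rec delta W_Sym)
  have M_lim: "(\<lambda>k. M (W k)) \<longlonglongrightarrow> v"
    by (rule firmly_nonexpansive_displacement_limit[OF subspace_Sym M_Sym M_firm v W0 W_step])
  let ?phi = "phi A Zbar Hbar"
  \<comment> \<open>As V ranges over \<open>Sym\<close>, so does \<open>V + U\<close>; hence the set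
    generating the cone is the range of M translated by \<open>Psi = - M U\<close>. The point of its
    closure nearest to \<open>Psi\<close> is \<open>Psi + v\<close>.\<close>
  have phi_eq: "?phi = - v"
  proof -
    have Psi_eq: "Psi A Zbar Hbar = - M U" using delta[OF USym] by (simp add: Psi_def U_def)
    have el: "projP A (Theta Zbar Hbar V) + projPperp A (Theta_perp Zbar Hbar V) = - M U + M (V + U)"
      if V: "V \<in> Sym" for V
    proof -
      have VU: "V + U \<in> Sym" by (intro Sym_add V USym)
      have T: "Theta Zbar Hbar V = F (V + U) - F U" by (simp add: Theta_def F_def U_def)
      have T': "Theta_perp Zbar Hbar V = G (V + U) - G U" by (simp add: Theta_perp_def G_def U_def)
      show ?thesis
        unfolding T T' G[OF VU] G[OF USym] projPperp_def P_def[symmetric] M_def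
        using P(1) by (simp add: linear_diff linear_add)
    qed
    have "{projP A (Theta Zbar Hbar V) + projPperp A (Theta_perp Zbar Hbar V) | V. V \<in> Sym}
        = (+) (- M U) ` (M ` Sym)"
    proof (intro equalityI subsetI)
      fix x assume "x \<in> (+) (- M U) ` (M ` Sym)"
      then obtain Y where Y: "Y \<in> Sym" "x = - M U + M Y" by blast
      have "x = projP A (Theta Zbar Hbar (Y - U)) + projPperp A (Theta_perp Zbar Hbar (Y - U))"
        using el[OF Sym_diff[OF Y(1) USym]] Y(2) by simp
      then show "x \<in> {projP A (Theta Zbar Hbar V) + projPperp A (Theta_perp Zbar Hbar V) | V. V \<in> Sym}"
        using Sym_diff[OF Y(1) USym] by blast
    qed (use el Sym_add USym in blast)
    then have "coneK A Zbar Hbar = closure ((+) (- M U) ` (M ` Sym))" by (simp only: coneK_def)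
    then have "closest_point (coneK A Zbar Hbar) (- M U) = - M U + v"
      using closest_point_eq_min_norm[OF v(1), of "- M U"] v(2) by auto
    then show ?thesis by (simp add: phi_def Psi_eq)
  qed
  have phi_Sym: "?phi \<in> Sym"
    unfolding phi_eq
    by (intro Sym_uminus Sym_tendsto[OF M_lim]) (auto intro: always_eventually M_Sym W_Sym)
  define a where "a k = F (W (Suc k)) - F (W k)" for k
  define c where "c k = G (W (Suc k)) - G (W k)" for k
  define d where "d k = W (Suc k) - W k" for k
  have d_lim: "d \<longlonglongrightarrow> ?phi"
    unfolding d_def phi_eq using tendsto_minus[OF M_lim] by (simp add: W_step)
  have d_split: "d k = a k + c k" for k by (simp add: d_def a_def c_def G W_Sym)
  have d_Suc: "d (Suc k) = P (c k) + (a k - P (a k))" for k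
  proof -
    have "d (Suc k) = d k - (M (W (Suc k)) - M (W k))" unfolding d_def by (simp add: W_step)
    also have "\<dots> = P (c k) + (a k - P (a k))"
      unfolding d_split a_def c_def G[OF W_Sym] M_def using P(1)
      by (simp add: linear_diff linear_add)
    finally show ?thesis .
  qed
  have ac: "a k \<bullet> c k \<ge> 0" for k
  proof -
    have "c k = (W (Suc k) - W k) - a k" using d_split[of k] by (simp add: d_def)
    then show ?thesis
      using F_firm[OF W_Sym W_Sym, of "Suc k" k]
      by (simp add: a_def[symmetric] inner_diff_right power2_norm_eq_inner)
  qed
  have bP: "bounded_linear P" using P(1) by (simp add: linear_conv_bounded_linear)
  note lims = complementary_components_limit[where d = d, OF bP P(2,3) ac d_split d_Suc d_lim]
  have Theta_phi: "Theta Zbar Hbar ?phi = ?phi - P ?phi"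
  proof -
    \<comment> \<open>These quotients tend to phi, and \<open>Theta\<close> of them is
      \<open>(F (W n) - F U) /\<^sub>R real n\<close>, whose limit is known. At n = 0 the factor is
      0, which \<open>Theta_scaleR\<close> also covers.\<close>
    define V where "V n = (W n - U) /\<^sub>R real n" for n
    have V_Sym: "V n \<in> Sym" for n unfolding V_def by (intro Sym_scaleR Sym_diff W_Sym USym)
    have "(\<lambda>n. (W n - U) /\<^sub>R real n) \<longlonglongrightarrow> ?phi"
      by (rule LIMSEQ_quotient_of_differences) (use d_lim in \<open>simp add: d_def[abs_def]\<close>)
    then have V_lim: "V \<longlonglongrightarrow> ?phi" by (simp add: V_def[abs_def])
    have "(\<lambda>n. (F (W n) - F U) /\<^sub>R real n) \<longlonglongrightarrow> ?phi - P ?phi"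
      by (rule LIMSEQ_quotient_of_differences) (use lims(1) in \<open>simp add: a_def[abs_def]\<close>)
    moreover have "(F (W n) - F U) /\<^sub>R real n = Theta Zbar Hbar (V n)" for n
    proof -
      have "Theta Zbar Hbar (V n) = inverse (real n) *\<^sub>R Theta Zbar Hbar (W n - U)"
        unfolding V_def by (intro Theta_scaleR Z H Sym_diff W_Sym USym) simp
      then show ?thesis by (simp add: Theta_def F_def U_def)
    qed
    ultimately have 1: "(\<lambda>n. Theta Zbar Hbar (V n)) \<longlonglongrightarrow> ?phi - P ?phi" by simp
    \<comment> \<open>Firm nonexpansiveness of F makes \<open>Theta\<close> 1-Lipschitz, which
      allows passing to the limit inside it.\<close>
    have bound: "norm (Theta Zbar Hbar (V n) - Theta Zbar Hbar ?phi) \<le> norm (V n - ?phi)" for n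
    proof -
      let ?f = "F (V n + U) - F (?phi + U)"
      have "(norm ?f)\<^sup>2 \<le> ?f \<bullet> ((V n + U) - (?phi + U))" by (intro F_firm Sym_add V_Sym phi_Sym USym)
      also have "\<dots> \<le> norm ?f * norm ((V n + U) - (?phi + U))" by (rule norm_cauchy_schwarz)
      finally have "norm ?f \<le> norm (V n - ?phi)" by (cases "?f = 0") (auto simp: power2_eq_square)
      then show ?thesis by (simp add: Theta_def F_def U_def)
    qed
    have V0: "(\<lambda>n. norm (V n - ?phi)) \<longlonglongrightarrow> 0"
      using V_lim by (simp add: tendsto_norm_zero_iff LIM_zero_iff)
    have "(\<lambda>n. Theta Zbar Hbar (V n) - Theta Zbar Hbar ?phi) \<longlonglongrightarrow> 0"
      by (rule Lim_null_comparison[OF always_eventually V0], rule allI, rule bound)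
    then have "(\<lambda>n. Theta Zbar Hbar (V n)) \<longlonglongrightarrow> Theta Zbar Hbar ?phi" by (simp add: LIM_zero_iff)
    from LIMSEQ_unique[OF this 1] show ?thesis .
  qed
  have Theta_perp_phi: "Theta_perp Zbar Hbar ?phi = P ?phi"
  proof -
    have "Theta_perp Zbar Hbar ?phi = G (?phi + U) - G U" by (simp add: Theta_perp_def G_def U_def)
    also have "\<dots> = ?phi - (F (?phi + U) - F U)" by (simp add: G Sym_add phi_Sym USym)
    also have "F (?phi + U) - F U = Theta Zbar Hbar ?phi" by (simp add: Theta_def F_def U_def)
    finally show ?thesis by (simp add: Theta_phi)
  qed
  show ?thesis
  proof (intro exI conjI)
    show "(\<lambda>k. dir2 proj_plus Zbar Hbar (W (Suc k)) - dir2 proj_plus Zbar Hbar (W k)) \<longlonglongrightarrow> ?phi - P ?phi"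
      using lims(1) by (simp add: a_def[abs_def] F_def)
    show "(\<lambda>k. dir2 proj_minus Zbar Hbar (W (Suc k)) - dir2 proj_minus Zbar Hbar (W k)) \<longlonglongrightarrow> P ?phi"
      using lims(2) by (simp add: c_def[abs_def] G_def)
    show "- (1/\<sigma>) *\<^sub>R P ?phi = - (1/\<sigma>) *\<^sub>R P ?phi" ..
    show "?phi = (?phi - P ?phi) - \<sigma> *\<^sub>R (- (1/\<sigma>) *\<^sub>R P ?phi)" using sigma_pos by simp
  qed (simp_all add: Theta_phi Theta_perp_phi)
qed

end
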